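(* Let $\mathbf{X}_{[1,\infty)}=\{X_n:n\ge1\}$ be a $\{0,1\}$-valued infinite exchangeable non-deterministic sequence such that $$\mathbb P(X_1=1)=c_1\qquad\text{and}\qquad \mathbb P(X_1=X_2=1)=c_2$$ for some constants $c_1,c_2$ with $0<c_1^2<c_2<c_1<1$. (a) If the system $$\frac{\alpha}{\alpha+\beta}=c_1,\qquad \frac{\alpha(\alpha+1)}{(\alpha+\beta)(\alpha+\beta+1)}=c_2$$ in the unknowns $(\alpha,\beta)\in(0,+\infty)\times(0,+\infty)$ admits an integer solution, then $\mathbf{X}_{[1,\infty)}$ is Hoeffding decomposable if, and only if, it is an urn process. (b) In general (without assuming that the system admits an integer solution), $\mathbf{X}_{[1,\infty)}$ is Hoeffding decomposable if, and only if, it is a P\'olya sequence with parameters $$\alpha^*=\frac{c_1(c_1-c_2)}{c_2-c_1^2},\qquad \beta^*=\frac{(1-c_1)(c_1-c_2)}{c_2-c_1^2}.$$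
   Context: Let $\mathbf{X}_{[1,\infty)}=\{X_n:n\ge 1\}$ be an infinite exchangeable sequence of $\{0,1\}$-valued random variables on a probability space $(\Omega,\mathcal F,\mathbb P)$ with $\mathcal F=\sigma(\mathbf{X}_{[1,\infty)})$. By de Finetti's theorem there is a unique probability measure $\gamma$ on $[0,1]$ (the de Finetti measure) such that $\mathbb P\{X_1=j_1,\dots,X_n=j_n\}=\int_{[0,1]}\theta^{\sum_k j_k}(1-\theta)^{n-\sum_k j_k}\,\gamma(\mathrm d\theta)$ for all $n\ge1$ and $(j_1,\dots,j_n)\in\{0,1\}^n$. The sequence is called non-deterministic if the support of $\gamma$ is not contained in $\{0\}\cup\{1\}$. P\'olya sequence: for real $\alpha,\beta>0$, $\mathbf{X}_{[1,\infty)}$ is a P\'olya sequence of parameters $\alpha,\beta$ if $\gamma(\mathrm d\theta)=\frac{1}{B(\alpha,\beta)}\theta^{\alpha-1}(1-\theta)^{\beta-1}\mathrm d\theta$ on $[0,1]$, where $B(\alpha,\beta)=\int_0^1\theta^{\alpha-1}(1-\theta)^{\beta-1}\mathrm d\theta$. Urn process: a random sequence $\{X_n:n\ge1\}$ with values in $\{0,1\}$ is an urn process if there exist a measurable function $f:[0,1]\to[0,1]$ and positive natural numbers $r,b>0$ such that, for every $n\ge1$, $$\mathbb P(X_{n+1}=1\mid X_1,\dots,X_n)=f\left(\frac{r+X_1+\cdots+X_n}{r+b+n}\right).$$ Hoeffding decomposability: write $\mathbf{X}_{[n]}=(X_1,\dots,X_n)$ and $\mathbf{X}_{[2,k]}=(X_2,\dots,X_k)$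 (for $k=1$ conditioning on $\mathbf{X}_{[2,k]}$ means taking the plain expectation). For $n\ge 2$, let $L_s(\mathbf{X}_{[n]})$ be the Hilbert space of random variables $T(X_1,\dots,X_n)$ with $T:\{0,1\}^n\to\mathbb R$ symmetric, with inner product $\langle T_1,T_2\rangle=\mathbb E[T_1(\mathbf{X}_{[n]})T_2(\mathbf{X}_{[n]})]$. Set $SU_0(\mathbf{X}_{[n]})=\mathbb R$ and, for $k=1,\dots,n$, let $SU_k(\mathbf{X}_{[n]})$ be the space of all random variables of the form $$F(\mathbf{X}_{[n]})=\sum_{1\le j_1<\dots<j_k\le n}\varphi(X_{j_1},\dots,X_{j_k}),\qquad \varphi:\{0,1\}^k\to\mathbb R \text{ symmetric}$$ (the kernel $\varphi$ is unique in the sense that two symmetric kernels representing the same $F$ agree a.s. when evaluated at $\mathbf{X}_{[k]}$). For $k=1,\dots,n$ let $SH_k(\mathbf{X}_{[n]})=SU_k(\mathbf{X}_{[n]})\cap SU_{k-1}(\mathbf{X}_{[n]})^{\perp}$, the orthogonal being taken in $L_s(\mathbf{X}_{[n]})$. The sequence $\mathbf{X}_{[1,\infty)}$ is Hoeffding decomposable if for every $n\ge2$ and every $k=1,\dots,n$: a random variable $F=\sum_{1\le j_1<\dots<j_k\le n}\varphi(X_{j_1},\dots,X_{j_k})\in SU_k(\mathbf{X}_{[n]})$, with symmetric kernel $\varphi:\{0,1\}^k\to\mathbb R$, belongs to $SH_k(\mathbf{X}_{[n]})$ if, and only if, $\mathbb E[\varphi(\mathbf{X}_{[k]})\mid \mathbf{X}_{[2,k]}]=0$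 a.s.-$\mathbb P$. *)

theory Defs
  imports "HOL-Probability.Probability"
begin

text \<open>
  A \<open>{0,1}\<close>-valued process is a family \<open>X :: nat \<Rightarrow> 'a \<Rightarrow> nat\<close> whose members are measurable into
  \<^term>\<open>count_space {0, 1 :: nat}\<close>. Indexing starts at 1; \<open>X 0\<close> is never used.
\<close>

definition exchangeable :: "'a measure \<Rightarrow> (nat \<Rightarrow> 'a \<Rightarrow> nat) \<Rightarrow> bool" where
  "exchangeable M X \<longleftrightarrow>
     (\<forall>n\<ge>1. \<forall>\<pi>. \<pi> permutes {1..n} \<longrightarrow>
        distr M (\<Pi>\<^sub>M i\<in>{1..n}. count_space {0, 1}) (\<lambda>\<omega>. \<lambda>i\<in>{1..n}. X (\<pi> i) \<omega>) =
        distr M (\<Pi>\<^sub>M i\<in>{1..n}. count_space {0, 1}) (\<lambda>\<omega>. \<lambda>i\<in>{1..n}. X i \<omega>))"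

text \<open>The \<open>\<sigma>\<close>-algebra generated by \<open>X i\<close>, \<open>i \<in> I\<close>; it is trivial for \<open>I = {}\<close>.\<close>

definition generated_by :: "'a measure \<Rightarrow> (nat \<Rightarrow> 'a \<Rightarrow> nat) \<Rightarrow> nat set \<Rightarrow> 'a measure" where
  "generated_by M X I = sigma (space M) {X i -` A \<inter> space M | i A. i \<in> I}"


definition is_de_finetti_measure ::
  "'a measure \<Rightarrow> (nat \<Rightarrow> 'a \<Rightarrow> nat) \<Rightarrow> real measure \<Rightarrow> bool" where
  "is_de_finetti_measure M X \<gamma> \<longleftrightarrow>
     prob_space \<gamma> \<and> sets \<gamma> = sets (restrict_space borel {0..1}) \<and>
     (\<forall>n\<ge>1. \<forall>j. (\<forall>k\<in>{1..n}. j k \<in> {0, 1}) \<longrightarrow>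
        \<P>(\<omega> in M. \<forall>k\<in>{1..n}. X k \<omega> = j k) =
        (\<integral>\<theta>. \<theta> ^ (\<Sum>k=1..n. j k) * (1 - \<theta>) ^ (n - (\<Sum>k=1..n. j k)) \<partial>\<gamma>))"

definition measure_support :: "'a::topological_space measure \<Rightarrow> 'a set" where
  "measure_support \<gamma> =
     {x \<in> space \<gamma>. \<forall>U. open U \<and> x \<in> U \<longrightarrow> emeasure \<gamma> (U \<inter> space \<gamma>) > 0}"

text \<open>
  By de Finetti's theorem an exchangeable sequence has exactly one measure \<open>\<gamma>\<close> as above, so the
  quantifier below speaks about \<^emph>\<open>the\<close> de Finetti measure.
\<close>

definition nondeterministic :: "'a measure \<Rightarrow> (nat \<Rightarrow> 'a \<Rightarrow> nat) \<Rightarrow> bool" where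
  "nondeterministic M X \<longleftrightarrow>
     (\<exists>\<gamma>. is_de_finetti_measure M X \<gamma> \<and> \<not> measure_support \<gamma> \<subseteq> {0} \<union> {1})"

text \<open>
  The normalising constant is the library's Beta function, which is Euler's integral of
  \<open>\<theta> powr (\<alpha> - 1) * (1 - \<theta>) powr (\<beta> - 1)\<close> over \<open>[0,1]\<close> by \<open>has_integral_Beta_real\<close>.
\<close>

definition beta_measure :: "real \<Rightarrow> real \<Rightarrow> real measure" where
  "beta_measure \<alpha> \<beta> =
     density (restrict_space lborel {0..1})
       (\<lambda>\<theta>. ennreal (1 / Beta \<alpha> \<beta> * \<theta> powr (\<alpha> - 1) * (1 - \<theta>) powr (\<beta> - 1)))"

definition polya_sequence ::
  "'a measure \<Rightarrow> (nat \<Rightarrow> 'a \<Rightarrow> nat) \<Rightarrow> real \<Rightarrow> real \<Rightarrow> bool" where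
  "polya_sequence M X \<alpha> \<beta> \<longleftrightarrow>
     \<alpha> > 0 \<and> \<beta> > 0 \<and> is_de_finetti_measure M X (beta_measure \<alpha> \<beta>)"

definition urn_process :: "'a measure \<Rightarrow> (nat \<Rightarrow> 'a \<Rightarrow> nat) \<Rightarrow> bool" where
  "urn_process M X \<longleftrightarrow>
     (\<exists>f \<in> restrict_space borel {0..1::real} \<rightarrow>\<^sub>M restrict_space borel {0..1::real}.
      \<exists>r b :: nat. r > 0 \<and> b > 0 \<and>
       (\<forall>n\<ge>1. AE \<omega> in M.
          real_cond_exp M (generated_by M X {1..n})
            (indicator {\<omega> \<in> space M. X (n + 1) \<omega> = 1}) \<omega> =
          f (real (r + (\<Sum>i=1..n. X i \<omega>)) / real (r + b + n))))"


text \<open>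
  Functions on \<open>{0,1}\<^sup>k\<close> are represented by functions on lists, only their values on
  \<open>binary_lists k\<close> being relevant. Two lists are rearrangements of each other iff they have the
  same multiset of entries.
\<close>

definition binary_lists :: "nat \<Rightarrow> nat list set" where
  "binary_lists k = {xs. length xs = k \<and> set xs \<subseteq> {0, 1}}"

definition symmetric_kernel :: "nat \<Rightarrow> (nat list \<Rightarrow> real) \<Rightarrow> bool" where
  "symmetric_kernel k \<phi> \<longleftrightarrow>
     (\<forall>xs\<in>binary_lists k. \<forall>ys\<in>binary_lists k. mset xs = mset ys \<longrightarrow> \<phi> xs = \<phi> ys)"

text \<open>\<open>subvec X J \<omega>\<close> lists the values \<open>X j \<omega>\<close>, \<open>j \<in> J\<close>, in increasing order of \<open>j\<close>.\<close>

definition subvec :: "(nat \<Rightarrow> 'a \<Rightarrow> nat) \<Rightarrow> nat set \<Rightarrow> 'a \<Rightarrow> nat list" where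
  "subvec X J \<omega> = map (\<lambda>j. X j \<omega>) (sorted_list_of_set J)"

definition U_stat ::
  "(nat \<Rightarrow> 'a \<Rightarrow> nat) \<Rightarrow> nat \<Rightarrow> nat \<Rightarrow> (nat list \<Rightarrow> real) \<Rightarrow> 'a \<Rightarrow> real" where
  "U_stat X n k \<phi> \<omega> = (\<Sum>J | J \<subseteq> {1..n} \<and> card J = k. \<phi> (subvec X J \<omega>))"

definition L_s :: "(nat \<Rightarrow> 'a \<Rightarrow> nat) \<Rightarrow> nat \<Rightarrow> ('a \<Rightarrow> real) set" where
  "L_s X n = {\<lambda>\<omega>. T (subvec X {1..n} \<omega>) | T. symmetric_kernel n T}"

definition SU :: "(nat \<Rightarrow> 'a \<Rightarrow> nat) \<Rightarrow> nat \<Rightarrow> nat \<Rightarrow> ('a \<Rightarrow> real) set" where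
  "SU X n k =
     (if k = 0 then {\<lambda>\<omega>. c | c. True}
      else {U_stat X n k \<phi> | \<phi>. symmetric_kernel k \<phi>})"

definition SH :: "'a measure \<Rightarrow> (nat \<Rightarrow> 'a \<Rightarrow> nat) \<Rightarrow> nat \<Rightarrow> nat \<Rightarrow> ('a \<Rightarrow> real) set" where
  "SH M X n k =
     SU X n k \<inter> {F \<in> L_s X n. \<forall>G \<in> SU X n (k - 1). (\<integral>\<omega>. F \<omega> * G \<omega> \<partial>M) = 0}"

definition hoeffding_decomposable :: "'a measure \<Rightarrow> (nat \<Rightarrow> 'a \<Rightarrow> nat) \<Rightarrow> bool" where
  "hoeffding_decomposable M X \<longleftrightarrow>
     (\<forall>n\<ge>2. \<forall>k\<in>{1..n}. \<forall>\<phi>. symmetric_kernel k \<phi> \<longrightarrow>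
        (U_stat X n k \<phi> \<in> SH M X n k \<longleftrightarrow>
         (AE \<omega> in M.
            real_cond_exp M (generated_by M X {2..k}) (\<lambda>\<omega>. \<phi> (subvec X {1..k} \<omega>)) \<omega> = 0)))"

end

theory Submission
  imports Defs
begin

text \<open>
  Write \<open>a i j\<close> for the probability of a given pattern of \<open>i\<close> ones and \<open>j\<close> zeros,
  \<open>p i j = a (i + 1) j / a i j\<close>, and \<open>S\<close> for the number of ones among the first \<open>n\<close>
  variables. A symmetric kernel of order \<open>k\<close> is a vector indexed by \<open>0..k\<close>, and up to a
  factor the only kernel with \<open>E[\<phi>(X\<^sub>1, \<dots>, X\<^sub>k) | X\<^sub>2, \<dots>, X\<^sub>k] = 0\<close> is
  \<open>\<phi> i = (-1)^i / a i (k - i)\<close>. Its U-statistic with \<open>n = k + 1\<close> is orthogonal to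
  \<open>SU\<^sub>k\<^sub>-\<^sub>1\<close> only if the second differences of \<open>s \<mapsto> p s (k - s)\<close> vanish; the recursion
  \<open>a i j = a (i + 1) j + a i (j + 1)\<close> then forces \<open>p i j = (\<alpha> + i) / (\<alpha> + \<beta> + i + j)\<close>.
  Conversely, in the Polya case elements of \<open>SU\<^sub>k\<^sub>-\<^sub>1\<close> are combinations of the
  rising factorials of \<open>\<alpha> + S\<close> of order \<open>d < k\<close>, and the pairing with any of these is a
  \<open>k\<close>-th difference of a polynomial of degree \<open>d\<close>.

  For an urn function \<open>f\<close>, exchangeability says that \<open>p\<close> is a martingale along its own urn
  dynamics and \<open>f\<close> is increasing on the rationals. If \<open>f z > z\<close>, the proportion drifts
  upwards from \<open>z\<close> and returns with exponentially small probability, so \<open>f\<close> is constant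
  just above \<open>z\<close>; the martingale equation propagates constancy to all of \<open>(0, 1)\<close>, which
  is the i.i.d. case excluded by \<open>c\<^sub>1\<^sup>2 < c\<^sub>2\<close>. By symmetry the only other possibility is
  \<open>f z = z\<close>.
\<close>

section \<open>Finite differences and symmetric kernels\<close>

text \<open>Pascal's rule, then a shift of one half of the sum. One order of the alternating sum is
  traded for one difference of \<open>f\<close>, which drives the induction below.\<close>

lemma alternating_binomial_Suc:
  fixes f :: "nat \<Rightarrow> real"
  shows "(\<Sum>i\<le>Suc k. (-1) ^ i * (Suc k choose i) * f i) =
    (\<Sum>i\<le>k. (-1) ^ i * (k choose i) * (f i - f (Suc i)))"
proof -
  have "(\<Sum>i\<le>Suc k. (-1) ^ i * (Suc k choose i) * f i) =
      f 0 + (\<Sum>i\<le>k. (-1) ^ Suc i * (Suc k choose Suc i) * f (Suc i))"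
    by (subst sum.atMost_Suc_shift) simp
  also have "\<dots> = f 0 + (\<Sum>i\<le>k. (-1) ^ Suc i * (k choose Suc i) * f (Suc i))
      - (\<Sum>i\<le>k. (-1) ^ i * (k choose i) * f (Suc i))"
    by (simp add: algebra_simps sum.distrib sum_negf sum_subtractf)
  also have "f 0 + (\<Sum>i\<le>k. (-1) ^ Suc i * (k choose Suc i) * f (Suc i)) =
      (\<Sum>i\<le>Suc k. (-1) ^ i * (k choose i) * f i)"
    by (subst sum.atMost_Suc_shift) simp
  also have "\<dots> = (\<Sum>i\<le>k. (-1) ^ i * (k choose i) * f i)" by simp
  finally show ?thesis by (simp only: right_diff_distrib sum_subtractf)
qed

text \<open>A \<open>k\<close>-th difference kills polynomials of degree below \<open>k\<close>.
  Rising factorials suit the induction: differencing one gives a multiple of a shifted rising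
  factorial of order \<open>d - 1\<close>.\<close>

lemma alternating_binomial_pochhammer:
  fixes x :: real
  assumes "d < k"
  shows "(\<Sum>i\<le>k. (-1) ^ i * (k choose i) * pochhammer (x + i) d) = 0"
  using assms
proof (induction k arbitrary: d x)
  case (Suc k)
  have step: "pochhammer (x + i) d - pochhammer (x + Suc i) d = - real d * pochhammer (x + 1 + i) (d - 1)" for i :: nat
  proof (cases d)
    case (Suc e)
    have "pochhammer (x + i) (Suc e) = (x + i) * pochhammer (x + 1 + i) e"
      by (simp add: pochhammer_rec algebra_simps)
    moreover have "pochhammer (x + Suc i) (Suc e) = pochhammer (x + 1 + i) e * (x + 1 + i + e)"
      by (simp add: pochhammer_Suc algebra_simps)
    ultimately show ?thesis using Suc by (simp add: algebra_simps)
  qed simp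
  have "(\<Sum>i\<le>Suc k. (-1) ^ i * (Suc k choose i) * pochhammer (x + i) d) =
      - real d * (\<Sum>i\<le>k. (-1) ^ i * (k choose i) * pochhammer (x + 1 + i) (d - 1))"
    unfolding alternating_binomial_Suc step by (simp add: sum_distrib_left algebra_simps)
  \<comment> \<open>For \<open>d = 0\<close> the factor \<open>real d\<close> vanishes; the
    induction hypothesis is used only for positive \<open>d\<close>.\<close>
  also have "\<dots> = 0"
  proof (cases d)
    case (Suc e)
    then show ?thesis using Suc.IH[of e "x + 1"] Suc.prems by simp
  qed simp
  finally show ?case .
qed simp

text \<open>Value of a U-statistic of order \<open>k\<close> on a word of length \<open>n\<close>
  with \<open>s\<close> ones, when the kernel depends only on the number \<open>i\<close> of ones
  among the chosen entries; see \<open>subset_sum_eq_u_sum\<close>.\<close>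

definition u_sum :: "nat \<Rightarrow> nat \<Rightarrow> (nat \<Rightarrow> real) \<Rightarrow> nat \<Rightarrow> real" where
  "u_sum n k \<phi> s = (\<Sum>i\<le>k. real (s choose i) * real ((n - s) choose (k - i)) * \<phi> i)"

lemma u_sum_0 [simp]: "u_sum n 0 \<psi> s = \<psi> 0"
  by (simp add: u_sum_def)

text \<open>Double counting: pick the \<open>s\<close> ones and then a \<open>k\<close>-subset
  containing \<open>i\<close> of them, or pick the \<open>k\<close>-subset first, then its
  \<open>i\<close> ones, then the \<open>r = s - i\<close> ones outside it.\<close>

lemma binomial_reindex:
  fixes F :: "nat \<Rightarrow> real"
  assumes "i \<le> k" "k \<le> n"
  shows "(\<Sum>s\<le>n. real (n choose s) * real (s choose i) * real ((n - s) choose (k - i)) * F s) =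
    real (n choose k) * real (k choose i) * (\<Sum>r\<le>n - k. real ((n - k) choose r) * F (i + r))"
proof -
  have prod: "(n choose (i + r)) * ((i + r) choose i) * ((n - (i + r)) choose (k - i)) =
      (n choose k) * (k choose i) * ((n - k) choose r)" if "r \<le> n - k" for r
  proof -
    have 1: "(n choose (i + r)) * ((i + r) choose i) = (n choose i) * ((n - i) choose r)"
      using choose_mult[of i "i + r" n] that assms by simp
    have 2: "((n - i) choose r) * ((n - i - r) choose (k - i)) = ((n - i) choose (k - i)) * ((n - k) choose r)"
    proof -
      have "((n - i) choose (r + (k - i))) * ((r + (k - i)) choose r) = ((n - i) choose r) * ((n - i - r) choose (k - i))"
        using choose_mult[of r "r + (k - i)" "n - i"] that assms by simp
      moreover have "((n - i) choose (r + (k - i))) * ((r + (k - i)) choose (k - i)) = ((n - i) choose (k - i)) * ((n - k) choose r)"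
        using choose_mult[of "k - i" "r + (k - i)" "n - i"] that assms by simp
      moreover have "((r + (k - i)) choose r) = ((r + (k - i)) choose (k - i))"
        using binomial_symmetric[of r "r + (k - i)"] by simp
      ultimately show ?thesis by simp
    qed
    have 3: "(n choose k) * (k choose i) = (n choose i) * ((n - i) choose (k - i))"
      using choose_mult[OF assms] .
    have "(n choose (i + r)) * ((i + r) choose i) * ((n - (i + r)) choose (k - i)) =
      (n choose i) * (((n - i) choose r) * ((n - i - r) choose (k - i)))"
      using 1 by (simp add: mult.assoc)
    also have "\<dots> = (n choose k) * (k choose i) * ((n - k) choose r)" using 2 3 by (simp add: mult.assoc)
    finally show ?thesis .
  qed
  \<comment> \<open>Outside the window from \<open>i\<close> to \<open>i + (n - k)\<close> one of
    the two inner binomials is zero.\<close>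
  have "(\<Sum>s\<le>n. real (n choose s) * real (s choose i) * real ((n - s) choose (k - i)) * F s) =
      (\<Sum>s\<in>{i..i + (n - k)}. real (n choose s) * real (s choose i) * real ((n - s) choose (k - i)) * F s)"
    using assms by (intro sum.mono_neutral_right) (auto simp: not_le)
  also have "\<dots> = (\<Sum>r\<le>n - k. real (n choose (i + r)) * real ((i + r) choose i) * real ((n - (i + r)) choose (k - i)) * F (i + r))"
    by (rule sum.reindex_bij_witness[of _ "\<lambda>r. i + r" "\<lambda>s. s - i"]) auto
  also have "\<dots> = (\<Sum>r\<le>n - k. real ((n choose (i + r)) * ((i + r) choose i) * ((n - (i + r)) choose (k - i))) * F (i + r))"
    by simp
  also have "\<dots> = (\<Sum>r\<le>n - k. real ((n choose k) * (k choose i) * ((n - k) choose r)) * F (i + r))"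
    by (intro sum.cong refl arg_cong2[where f = times] arg_cong[where f = real] prod) auto
  finally show ?thesis by (simp add: sum_distrib_left mult.assoc)
qed

text \<open>Sums \<open>\<psi>\<close> over the \<open>k\<close> words obtained by deleting one
  entry: \<open>i\<close> deletions remove a one, \<open>k - i\<close> remove a zero. The
  out-of-range values \<open>\<psi> (0 - 1)\<close> and \<open>\<psi> k\<close> get coefficient
  \<open>0\<close>.\<close>

definition lift_kernel :: "nat \<Rightarrow> (nat \<Rightarrow> real) \<Rightarrow> nat \<Rightarrow> real" where
  "lift_kernel k \<psi> i = real i * \<psi> (i - 1) + real (k - i) * \<psi> i"

text \<open>Each \<open>(k - 1)\<close>-subset of the \<open>n\<close> positions lies in
  \<open>n - k + 1\<close> subsets of size \<open>k\<close>. Thus a U-statistic of order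
  \<open>k - 1\<close> is also one of order \<open>k\<close>.\<close>

lemma u_sum_lift:
  assumes "1 \<le> k" "k \<le> n" "s \<le> n"
  shows "u_sum n k (lift_kernel k \<psi>) s = real (n - k + 1) * u_sum n (k - 1) \<psi> s"
proof -
  obtain m where k: "k = Suc m" using assms by (cases k) auto
  have absorb: "real (p choose Suc i) * real (Suc i) = real (p choose i) * (real p - real i)" for p i
  proof (cases "i \<le> p")
    case True
    have "(p choose Suc i) * Suc i = (p choose i) * (p - i)"
      using binomial_absorb_comp[of p i] by (metis Suc_times_binomial_eq binomial_absorption mult.commute binomial_absorb_comp) 
    then show ?thesis using True by (metis of_nat_mult of_nat_diff)
  qed (simp add: not_le binomial_eq_0)
  have "u_sum n k (lift_kernel k \<psi>) s =
      (\<Sum>i\<le>Suc m. real (s choose i) * ((n - s) choose (Suc m - i)) * (real i * \<psi> (i - 1))) +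
      (\<Sum>i\<le>Suc m. real (s choose i) * ((n - s) choose (Suc m - i)) * (real (Suc m - i) * \<psi> i))"
    by (simp only: u_sum_def lift_kernel_def k sum.distrib[symmetric] distrib_left)
  also have "(\<Sum>i\<le>Suc m. real (s choose i) * ((n - s) choose (Suc m - i)) * (real i * \<psi> (i - 1))) =
      (\<Sum>i\<le>m. real (s choose i) * (real s - real i) * ((n - s) choose (m - i)) * \<psi> i)"
    unfolding absorb[symmetric] by (subst sum.atMost_Suc_shift) (simp add: algebra_simps)
  also have "(\<Sum>i\<le>Suc m. real (s choose i) * ((n - s) choose (Suc m - i)) * (real (Suc m - i) * \<psi> i)) =
      (\<Sum>i\<le>m. real (s choose i) * (((n - s) choose (m - i)) * (real (n - s) - real (m - i))) * \<psi> i)"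
    unfolding absorb[symmetric] by (auto intro!: sum.cong simp: Suc_diff_le algebra_simps)
  also have "(\<Sum>i\<le>m. real (s choose i) * (real s - real i) * ((n - s) choose (m - i)) * \<psi> i) + \<dots> =
     (\<Sum>i\<le>m. real (n - k + 1) * (real (s choose i) * ((n - s) choose (m - i)) * \<psi> i))"
    unfolding sum.distrib[symmetric]
  proof (intro sum.cong refl)
    fix i assume "i \<in> {..m}"
    then have "real (n - k + 1) = (real s - real i) + (real (n - s) - real (m - i))"
      using assms by (simp add: k of_nat_diff)
    then show "real (s choose i) * (real s - real i) * ((n - s) choose (m - i)) * \<psi> i +
      real (s choose i) * (((n - s) choose (m - i)) * (real (n - s) - real (m - i))) * \<psi> i =
      real (n - k + 1) * (real (s choose i) * ((n - s) choose (m - i)) * \<psi> i)"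
      by (simp only:) (simp add: algebra_simps)
  qed
  finally show ?thesis by (simp add: u_sum_def k sum_distrib_left)
qed

text \<open>The system is triangular: at \<open>s = i\<close> the terms with \<open>j > i\<close>
  vanish because of \<open>i choose j\<close>, those with \<open>j < i\<close> by induction, and the
  diagonal coefficient is positive.\<close>

lemma u_sum_inj:
  assumes zero: "\<And>s. s \<le> n \<Longrightarrow> u_sum n m \<psi> s = 0" and "m \<le> n" "i \<le> m"
  shows "\<psi> i = 0"
  using assms(3)
proof (induction i rule: less_induct)
  case (less i)
  have "0 = u_sum n m \<psi> i" using zero[of i] less.prems assms by simp
  also have "\<dots> = (\<Sum>j\<in>{i}. real (i choose j) * real ((n - i) choose (m - j)) * \<psi> j)"
    unfolding u_sum_def
  proof (rule sum.mono_neutral_right)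
    show "\<forall>j\<in>{..m} - {i}. real (i choose j) * real (n - i choose (m - j)) * \<psi> j = 0"
    proof
      fix j assume j: "j \<in> {..m} - {i}"
      then consider "j < i" | "i < j" by fastforce
      then show "real (i choose j) * real (n - i choose (m - j)) * \<psi> j = 0"
        using less by cases auto
    qed
  qed (use less in auto)
  also have "\<dots> = real ((n - i) choose (m - i)) * \<psi> i" by simp
  finally show ?case using less.prems assms by (auto simp: not_less diff_le_mono)
qed

text \<open>Lifting is a first-order recursion for \<open>\<psi>\<close>, solved by partial sums.
  There is one equation more than there are unknowns, and the last one holds because the full
  alternating sum is zero.\<close>

lemma lift_kernel_surj:
  fixes \<phi> :: "nat \<Rightarrow> real"
  assumes "1 \<le> k" and alt: "(\<Sum>l\<le>k. (-1) ^ l * (k choose l) * \<phi> l) = 0"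
  obtains \<psi> where "\<And>i. i \<le> k \<Longrightarrow> lift_kernel k \<psi> i = \<phi> i"
proof -
  define \<sigma> where "\<sigma> i = (\<Sum>l\<le>i. (-1) ^ l * (k choose l) * \<phi> l)" for i
  \<comment> \<open>At \<open>i = k\<close> this is a division by zero with value \<open>0\<close>,
    harmless because \<open>\<psi> k\<close> enters \<open>lift_kernel\<close> with coefficient
    \<open>0\<close>.\<close>
  define \<psi> where "\<psi> i = (-1) ^ i * \<sigma> i / (real (k - i) * (k choose i))" for i
  have "lift_kernel k \<psi> i = \<phi> i" if i: "i \<le> k" for i
  proof -
    have right: "real (k - i) * \<psi> i = (-1) ^ i * \<sigma> i / (k choose i)"
    proof (cases "i = k")
      case True then show ?thesis using alt by (simp add: \<sigma>_def)
    qed (use i in \<open>simp add: \<psi>_def\<close>)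
    show ?thesis
    proof (cases i)
      case 0
      then show ?thesis using right by (simp add: lift_kernel_def \<sigma>_def)
    next
      case (Suc j)
      have "real (k - j) * (k choose j) = real (Suc j) * (k choose Suc j)"
        using binomial_absorb_comp[of k j] i Suc
        by (metis (no_types, lifting) of_nat_mult binomial_absorption mult.commute Suc_times_binomial_eq)
      then have "real i * \<psi> (i - 1) = (-1) ^ j * \<sigma> j / (k choose i)"
        using Suc by (simp add: \<psi>_def)
      then have "lift_kernel k \<psi> i = (-1) ^ i * (\<sigma> i - \<sigma> j) / (k choose i)"
        unfolding lift_kernel_def right by (simp add: Suc diff_divide_distrib right_diff_distrib)
      also have "\<sigma> i - \<sigma> j = (-1) ^ i * (k choose i) * \<phi> i" by (simp add: \<sigma>_def Suc)
      also have "(-1) ^ i * ((-1) ^ i * (k choose i) * \<phi> i) / (k choose i) = \<phi> i"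
        using i by (simp add: mult.assoc[symmetric] power_add[symmetric])
      finally show ?thesis .
    qed
  qed
  then show ?thesis using that by blast
qed


lemma u_sum_full:
  assumes "s \<le> n" shows "u_sum n n \<phi> s = \<phi> s"
proof -
  have "u_sum n n \<phi> s = (\<Sum>i\<in>{s}. real (s choose i) * real ((n - s) choose (n - i)) * \<phi> i)"
    unfolding u_sum_def using assms by (intro sum.mono_neutral_right) (auto simp: not_le)
  then show ?thesis by simp
qed

text \<open>Polynomials in \<open>s\<close> of degree at most \<open>d\<close>, in the basis of
  rising factorials of \<open>\<alpha> + s\<close>. Only \<open>s \<le> n\<close> matters, since
  \<open>n - s\<close> is a truncated subtraction.\<close>

definition pochhammer_span :: "real \<Rightarrow> nat \<Rightarrow> nat \<Rightarrow> (nat \<Rightarrow> real) \<Rightarrow> bool" where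
  "pochhammer_span \<alpha> n d g \<longleftrightarrow>
    (\<exists>c. \<forall>s\<le>n. g s = (\<Sum>e\<le>d. c e * pochhammer (\<alpha> + real s) e))"

lemma pochhammer_span_linear_mult:
  assumes "pochhammer_span \<alpha> n d g"
    and eq: "\<And>s. s \<le> n \<Longrightarrow> g' s = (A + B * real s) * g s"
  shows "pochhammer_span \<alpha> n (Suc d) g'"
proof -
  obtain c where c: "\<And>s. s \<le> n \<Longrightarrow> g s = (\<Sum>e\<le>d. c e * pochhammer (\<alpha> + real s) e)"
    using assms(1) by (auto simp: pochhammer_span_def)
  \<comment> \<open>Comes from \<open>(A + B * s) * P e = B * P (e + 1) + (A - B * (\<alpha> + e)) *
    P e\<close>, where \<open>P e\<close> is the rising factorial of order \<open>e\<close>.\<close>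
  define c' where "c' e = (if e = 0 then 0 else B * c (e - 1)) +
    (if e \<le> d then (A - B * (\<alpha> + e)) * c e else 0)" for e
  have "g' s = (\<Sum>e\<le>Suc d. c' e * pochhammer (\<alpha> + real s) e)" if "s \<le> n" for s
  proof -
    have "(\<Sum>e\<le>Suc d. c' e * pochhammer (\<alpha> + real s) e) =
      (\<Sum>e\<le>Suc d. (if e = 0 then 0 else B * c (e - 1)) * pochhammer (\<alpha> + real s) e) +
      (\<Sum>e\<le>Suc d. (if e \<le> d then (A - B * (\<alpha> + e)) * c e else 0) * pochhammer (\<alpha> + real s) e)"
      by (simp only: c'_def distrib_right sum.distrib)
    also have "(\<Sum>e\<le>Suc d. (if e = 0 then 0 else B * c (e - 1)) * pochhammer (\<alpha> + real s) e) =
      (\<Sum>e\<le>d. B * c e * pochhammer (\<alpha> + real s) (Suc e))"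
      by (subst sum.atMost_Suc_shift) simp
    also have "(\<Sum>e\<le>Suc d. (if e \<le> d then (A - B * (\<alpha> + e)) * c e else 0) * pochhammer (\<alpha> + real s) e) =
      (\<Sum>e\<le>d. (A - B * (\<alpha> + e)) * c e * pochhammer (\<alpha> + real s) e)"
      by simp
    also have "(\<Sum>e\<le>d. B * c e * pochhammer (\<alpha> + real s) (Suc e)) + \<dots> =
      (\<Sum>e\<le>d. (A + B * real s) * (c e * pochhammer (\<alpha> + real s) e))"
      by (simp only: sum.distrib[symmetric]) (simp add: pochhammer_Suc algebra_simps)
    also have "\<dots> = g' s" using that by (simp only: eq c sum_distrib_left)
    finally show ?thesis by simp
  qed
  then show ?thesis unfolding pochhammer_span_def by blast
qed

lemma binomial_Suc_real: "real (p choose Suc i) = real (p choose i) * ((real p - real i) / real (Suc i))"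
proof (cases "i \<le> p")
  case True
  have "(p choose Suc i) * Suc i = (p choose i) * (p - i)"
    using binomial_absorb_comp[of p i] by (metis Suc_times_binomial_eq binomial_absorption mult.commute)
  then have "real (p choose Suc i) * real (Suc i) = real (p choose i) * (real p - real i)"
    using True by (metis of_nat_mult of_nat_diff)
  then show ?thesis by (simp add: field_simps)
qed (simp add: not_le binomial_eq_0)

text \<open>Raising \<open>i\<close> by one multiplies by \<open>(s - i) / (i + 1)\<close>, raising
  \<open>j\<close> by one multiplies by \<open>(n - s - j) / (j + 1)\<close>; both factors are
  linear in \<open>s\<close>.\<close>

lemma pochhammer_span_binomials:
  "pochhammer_span \<alpha> n (i + j) (\<lambda>s. real (s choose i) * real ((n - s) choose j))"
proof (induction j)
  case 0
  show ?case
  proof (induction i)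
    case 0
    have "\<forall>s\<le>n. (1::real) = (\<Sum>e\<le>(0::nat). 1 * pochhammer (\<alpha> + real s) e)" by simp
    then show ?case unfolding pochhammer_span_def by (intro exI[of _ "\<lambda>_. 1"]) simp
  next
    case (Suc i)
    have "pochhammer_span \<alpha> n (Suc i) (\<lambda>s. real (s choose Suc i) * real ((n - s) choose 0))"
      using Suc by (intro pochhammer_span_linear_mult[where A = "- real i / real (Suc i)" and B = "1 / real (Suc i)"])
        (auto simp: binomial_Suc_real diff_divide_distrib algebra_simps)
    then show ?case by simp
  qed
next
  case (Suc j)
  have "pochhammer_span \<alpha> n (Suc (i + j)) (\<lambda>s. real (s choose i) * real ((n - s) choose Suc j))"
    using Suc by (rule pochhammer_span_linear_mult[where A = "(real n - real j) / real (Suc j)" and B = "- 1 / real (Suc j)"])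
      (simp add: binomial_Suc_real of_nat_diff add_divide_distrib diff_divide_distrib algebra_simps)
  then show ?case by simp
qed

lemma pochhammer_span_sum:
  assumes "\<And>i. i \<le> m \<Longrightarrow> pochhammer_span \<alpha> n d (g i)"
  shows "pochhammer_span \<alpha> n d (\<lambda>s. \<Sum>i\<le>m. g i s * \<psi> i)"
proof -
  have "\<forall>i\<in>{..m}. \<exists>c. \<forall>s\<le>n. g i s = (\<Sum>e\<le>d. c e * pochhammer (\<alpha> + real s) e)"
    using assms unfolding pochhammer_span_def by blast
  from bchoice[OF this] obtain c
    where "\<forall>i\<in>{..m}. \<forall>s\<le>n. g i s = (\<Sum>e\<le>d. c i e * pochhammer (\<alpha> + real s) e)" ..
  then have c: "g i s = (\<Sum>e\<le>d. c i e * pochhammer (\<alpha> + real s) e)" if "i \<le> m" "s \<le> n" for i s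
    using that by simp
  define c' where "c' e = (\<Sum>i\<le>m. c i e * \<psi> i)" for e
  have "(\<Sum>i\<le>m. g i s * \<psi> i) = (\<Sum>e\<le>d. c' e * pochhammer (\<alpha> + real s) e)"
    if "s \<le> n" for s
  proof -
    have "(\<Sum>i\<le>m. g i s * \<psi> i) = (\<Sum>i\<le>m. \<Sum>e\<le>d. c i e * pochhammer (\<alpha> + real s) e * \<psi> i)"
      using that by (intro sum.cong refl) (simp add: c sum_distrib_right)
    also have "\<dots> = (\<Sum>e\<le>d. \<Sum>i\<le>m. c i e * pochhammer (\<alpha> + real s) e * \<psi> i)" by (rule sum.swap)
    also have "\<dots> = (\<Sum>e\<le>d. c' e * pochhammer (\<alpha> + real s) e)"
      unfolding c'_def by (intro sum.cong refl) (simp add: sum_distrib_left mult_ac)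
    finally show ?thesis .
  qed
  then show ?thesis unfolding pochhammer_span_def by blast
qed

lemma pochhammer_span_u_sum: "pochhammer_span \<alpha> n m (u_sum n m \<psi>)"
proof -
  have "pochhammer_span \<alpha> n m (\<lambda>s. \<Sum>i\<le>m. real (s choose i) * real ((n - s) choose (m - i)) * \<psi> i)"
  proof (rule pochhammer_span_sum)
    fix i assume "i \<le> m"
    then show "pochhammer_span \<alpha> n m (\<lambda>s. real (s choose i) * real ((n - s) choose (m - i)))"
      using pochhammer_span_binomials[of \<alpha> n i "m - i"] by simp
  qed
  then show ?thesis unfolding u_sum_def .
qed

section \<open>Pattern probabilities, predictive probabilities and degenerate kernels\<close>

locale pattern_probabilities =
  fixes a :: "nat \<Rightarrow> nat \<Rightarrow> real"
  assumes a_pos: "a i j > 0"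
    and a_merge: "a (Suc i) j + a i (Suc j) = a i j"
    and a_00: "a 0 0 = 1"
begin

text \<open>Orthogonality to \<open>SU X n (k - 1)\<close> in coordinates:
  \<open>(n choose s) * a s (n - s)\<close> is the probability of exactly \<open>s\<close> ones
  among \<open>n\<close> variables.\<close>

definition orthogonal_kernel :: "nat \<Rightarrow> nat \<Rightarrow> (nat \<Rightarrow> real) \<Rightarrow> bool" where
  "orthogonal_kernel n k \<phi> \<longleftrightarrow>
    (\<forall>\<psi>. (\<Sum>s\<le>n. real (n choose s) * a s (n - s) * (u_sum n k \<phi> s * u_sum n (k - 1) \<psi> s)) = 0)"

text \<open>The vanishing conditional expectation given \<open>t\<close> ones in the last
  \<open>k - 1\<close> places; the two terms belong to a first entry \<open>1\<close> and a first
  entry \<open>0\<close>.\<close>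

definition degenerate_kernel :: "nat \<Rightarrow> (nat \<Rightarrow> real) \<Rightarrow> bool" where
  "degenerate_kernel k \<phi> \<longleftrightarrow> (\<forall>t<k. a (Suc t) (k - 1 - t) * \<phi> (Suc t) + a t (k - t) * \<phi> t = 0)"

definition decomposable :: bool where
  "decomposable \<longleftrightarrow> (\<forall>n\<ge>2. \<forall>k\<in>{1..n}. \<forall>\<phi>. orthogonal_kernel n k \<phi> \<longleftrightarrow> degenerate_kernel k \<phi>)"

text \<open>Conditional probability that the next variable is \<open>1\<close> after
  \<open>i\<close> ones and \<open>j\<close> zeros.\<close>

definition up :: "nat \<Rightarrow> nat \<Rightarrow> real" where
  "up i j = a (Suc i) j / a i j"

definition polya :: "real \<Rightarrow> real \<Rightarrow> bool" where
  "polya \<alpha> \<beta> \<longleftrightarrow> (\<forall>i j. up i j * (\<alpha> + \<beta> + i + j) = \<alpha> + i)"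

lemma up_pos: "up i j > 0"
  unfolding up_def by (intro divide_pos_pos a_pos)

lemma a_Suc_left: "a (Suc i) j = up i j * a i j"
  using a_pos[of i j] by (simp add: up_def)

lemma a_Suc_right: "a i (Suc j) = (1 - up i j) * a i j"
proof -
  have "a i (Suc j) = a i j - a (Suc i) j" using a_merge[of i j] by linarith
  then show ?thesis by (simp add: a_Suc_left left_diff_distrib)
qed

lemma up_less_1: "up i j < 1"
  using a_pos[of i j] a_pos[of i "Suc j"] unfolding a_Suc_right by (simp add: zero_less_mult_iff)

text \<open>The predictive probability is a martingale for the draws it governs itself: this is
  \<open>a_merge\<close> at \<open>(Suc i, j)\<close> divided by \<open>a i j\<close>.\<close>

lemma up_harmonic: "up i j = up i j * up (Suc i) j + (1 - up i j) * up i (Suc j)"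
proof -
  have "up i j * a i j = a (Suc i) j" by (simp only: a_Suc_left)
  also have "\<dots> = a (Suc (Suc i)) j + a (Suc i) (Suc j)" by (rule a_merge[symmetric])
  also have "\<dots> = (up i j * up (Suc i) j + (1 - up i j) * up i (Suc j)) * a i j"
    by (simp only: a_Suc_left) (simp add: a_Suc_right algebra_simps)
  finally have "up i j * a i j = (up i j * up (Suc i) j + (1 - up i j) * up i (Suc j)) * a i j" .
  moreover have "a i j \<noteq> 0" using a_pos[of i j] by simp
  ultimately show ?thesis unfolding mult_cancel_right by simp
qed

text \<open>The degenerate kernels of order \<open>k\<close> are exactly its multiples.\<close>

definition alternating :: "nat \<Rightarrow> nat \<Rightarrow> real" where
  "alternating k i = (-1) ^ i / a i (k - i)"

lemma degenerate_alternating: "degenerate_kernel k (alternating k)"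
  unfolding degenerate_kernel_def
proof (intro allI impI)
  fix t assume "t < k"
  then have "k - 1 - t = k - Suc t" by simp
  then show "a (Suc t) (k - 1 - t) * alternating k (Suc t) + a t (k - t) * alternating k t = 0"
    using a_pos[of "Suc t" "k - Suc t"] a_pos[of t "k - t"] by (simp add: alternating_def)
qed

text \<open>Degeneracy is a first-order recursion in \<open>t\<close> with nonzero coefficients, so
  the value at \<open>0\<close> fixes the kernel.\<close>

lemma degenerate_eq_alternating:
  assumes "degenerate_kernel k \<phi>" "i \<le> k"
  shows "\<phi> i = \<phi> 0 * a 0 k * alternating k i"
  using assms(2)
proof (induction i)
  case 0
  then show ?case using a_pos[of 0 k] by (simp add: alternating_def)
next
  case (Suc i)
  have "a (Suc i) (k - Suc i) * \<phi> (Suc i) + a i (k - i) * \<phi> i = 0"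
    using assms(1) Suc.prems by (auto simp: degenerate_kernel_def)
  then show ?case using Suc a_pos[of "Suc i" "k - Suc i"] a_pos[of i "k - i"]
    by (simp add: alternating_def field_simps)
qed

lemma degenerate_kernel_scale:
  assumes "\<And>i. i \<le> k \<Longrightarrow> \<phi> i = c * alternating k i"
  shows "degenerate_kernel k \<phi>"
proof -
  have "a (Suc t) (k - 1 - t) * \<phi> (Suc t) + a t (k - t) * \<phi> t =
    c * (a (Suc t) (k - 1 - t) * alternating k (Suc t) + a t (k - t) * alternating k t)" if "t < k" for t
    using that assms by (simp add: algebra_simps)
  then show ?thesis using degenerate_alternating[of k] by (simp add: degenerate_kernel_def)
qed

text \<open>Multiply the predictive probabilities along the word that starts with all
  \<open>j\<close> zeros and then has the \<open>i\<close> ones.\<close>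

lemma polya_pochhammer:
  assumes "polya \<alpha> \<beta>" "\<alpha> > 0" "\<beta> > 0"
  shows "a i j = pochhammer \<alpha> i * pochhammer \<beta> j / pochhammer (\<alpha> + \<beta>) (i + j)"
proof -
  have up: "up i j = (\<alpha> + i) / (\<alpha> + \<beta> + i + j)" for i j
  proof -
    have "\<alpha> + \<beta> + i + j > 0" using assms by simp
    then show ?thesis using assms(1) by (simp add: polya_def eq_divide_eq)
  qed
  have down: "1 - up i j = (\<beta> + j) / (\<alpha> + \<beta> + i + j)" for i j
  proof -
    have "\<alpha> + \<beta> + i + j > 0" using assms by simp
    then show ?thesis by (simp add: up divide_simps)
  qed
  have col: "a 0 j = pochhammer \<beta> j / pochhammer (\<alpha> + \<beta>) j" for j
    by (induction j) (simp_all add: a_00 a_Suc_right down pochhammer_Suc mult.commute)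
  show ?thesis
    by (induction i) (simp_all add: col a_Suc_left up pochhammer_Suc mult.commute add.assoc)
qed

text \<open>Exchange the sums over \<open>s\<close> and \<open>i\<close>. For fixed \<open>i\<close>
  the inner sum is a Vandermonde convolution, and what remains is a \<open>k\<close>-th difference
  of a rising factorial of order \<open>d < k\<close>.\<close>

lemma u_sum_alternating_orthogonal:
  assumes polya: "polya \<alpha> \<beta>" "\<alpha> > 0" "\<beta> > 0" and "d < k" "k \<le> n"
  shows "(\<Sum>s\<le>n. real (n choose s) * a s (n - s) * (u_sum n k (alternating k) s * pochhammer (\<alpha> + s) d)) = 0"
proof -
  note a_eq = polya_pochhammer[OF polya]
  \<comment> \<open>All factors of the inner sum that do not depend on \<open>i\<close>.\<close>
  define C where "C = (n choose k) * pochhammer (\<alpha> + \<beta>) k / pochhammer (\<alpha> + \<beta>) n * pochhammer (\<alpha> + \<beta> + k + d) (n - k)"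
  have inner: "alternating k i * (\<Sum>s\<le>n. real (n choose s) * real (s choose i) * real ((n - s) choose (k - i)) *
        (a s (n - s) * pochhammer (\<alpha> + s) d)) = C * ((-1) ^ i * (k choose i) * pochhammer (\<alpha> + i) d)"
    if "i \<le> k" for i
  proof -
    have nz: "pochhammer \<alpha> i \<noteq> 0" "pochhammer \<beta> (k - i) \<noteq> 0" "pochhammer (\<alpha> + \<beta>) k \<noteq> 0"
      using polya by (auto simp: pochhammer_eq_0_iff add_eq_0_iff)
    \<comment> \<open>Split the rising factorials of \<open>a\<close> after \<open>i\<close> and
      \<open>k - i\<close> steps, so that \<open>r\<close> occurs only in two factors ready for
      convolution.\<close>
    have summand: "a (i + r) (n - (i + r)) * pochhammer (\<alpha> + (i + r)) d =
        pochhammer \<alpha> i * pochhammer \<beta> (k - i) / pochhammer (\<alpha> + \<beta>) n * pochhammer (\<alpha> + i) d *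
        (pochhammer (\<alpha> + i + d) r * pochhammer (\<beta> + (k - i)) (n - k - r))" if "r \<le> n - k" for r
    proof -
      have 1: "pochhammer \<alpha> (i + r) = pochhammer \<alpha> i * pochhammer (\<alpha> + i) r" by (rule pochhammer_product')
      have 2: "pochhammer \<beta> (n - (i + r)) = pochhammer \<beta> (k - i) * pochhammer (\<beta> + (k - i)) (n - k - r)"
        using pochhammer_product'[of \<beta> "k - i" "n - k - r"] that \<open>i \<le> k\<close> assms by simp
      have 3: "pochhammer (\<alpha> + i) r * pochhammer (\<alpha> + (i + r)) d = pochhammer (\<alpha> + i) d * pochhammer (\<alpha> + i + d) r"
        using pochhammer_product'[of "\<alpha> + i" r d] pochhammer_product'[of "\<alpha> + i" d r] by (simp add: add.commute add.left_commute)
      have 4: "i + r + (n - (i + r)) = n" using that \<open>i \<le> k\<close> assms by simp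
      have "a (i + r) (n - (i + r)) * pochhammer (\<alpha> + (i + r)) d =
        pochhammer \<alpha> i * pochhammer \<beta> (k - i) / pochhammer (\<alpha> + \<beta>) n *
        (pochhammer (\<alpha> + i) r * pochhammer (\<alpha> + (i + r)) d) * pochhammer (\<beta> + (k - i)) (n - k - r)"
        unfolding a_eq 4 1 2 by simp
      then show ?thesis unfolding 3 by simp
    qed
    have "(\<Sum>s\<le>n. real (n choose s) * real (s choose i) * real ((n - s) choose (k - i)) *
        (a s (n - s) * pochhammer (\<alpha> + s) d)) =
      real (n choose k) * real (k choose i) * (\<Sum>r\<le>n - k. real ((n - k) choose r) *
        (a (i + r) (n - (i + r)) * pochhammer (\<alpha> + (i + r)) d))"
      using binomial_reindex[OF that \<open>k \<le> n\<close>, of "\<lambda>s. a s (n - s) * pochhammer (\<alpha> + s) d"] by simp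
    also have "(\<Sum>r\<le>n - k. real ((n - k) choose r) *
        (a (i + r) (n - (i + r)) * pochhammer (\<alpha> + (i + r)) d)) =
      (\<Sum>r\<le>n - k. pochhammer \<alpha> i * pochhammer \<beta> (k - i) / pochhammer (\<alpha> + \<beta>) n * pochhammer (\<alpha> + i) d *
        (real ((n - k) choose r) * pochhammer (\<alpha> + i + d) r * pochhammer (\<beta> + (k - i)) (n - k - r)))"
      by (intro sum.cong refl) (simp add: summand del: of_nat_add)
    \<comment> \<open>Vandermonde's convolution for rising factorials. The two parameters add up to
      a number free of \<open>i\<close>, while the prefactors in \<open>\<alpha>\<close> and
      \<open>\<beta>\<close> cancel against \<open>alternating k i\<close>, leaving the sign and the
      rising factorial of order \<open>d\<close>.\<close>
    also have "\<dots> = pochhammer \<alpha> i * pochhammer \<beta> (k - i) / pochhammer (\<alpha> + \<beta>) n * pochhammer (\<alpha> + i) d *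
        pochhammer ((\<alpha> + i + d) + (\<beta> + (k - i))) (n - k)"
      unfolding pochhammer_binomial_sum sum_distrib_left by simp
    also have "(\<alpha> + i + d) + (\<beta> + (k - i)) = \<alpha> + \<beta> + k + d" using that by (simp add: of_nat_diff)
    finally show ?thesis using nz that
      by (simp add: alternating_def a_eq C_def)
  qed
  have "(\<Sum>s\<le>n. real (n choose s) * a s (n - s) * (u_sum n k (alternating k) s * pochhammer (\<alpha> + s) d)) =
    (\<Sum>s\<le>n. \<Sum>i\<le>k. alternating k i * (real (n choose s) * real (s choose i) * real ((n - s) choose (k - i)) *
        (a s (n - s) * pochhammer (\<alpha> + s) d)))"
    unfolding u_sum_def sum_distrib_left sum_distrib_right by (intro sum.cong refl) (simp add: mult_ac)
  also have "\<dots> = (\<Sum>i\<le>k. alternating k i * (\<Sum>s\<le>n. (real (n choose s) * real (s choose i) * real ((n - s) choose (k - i)) *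
        (a s (n - s) * pochhammer (\<alpha> + s) d))))"
    by (subst sum.swap) (simp add: sum_distrib_left)
  also have "\<dots> = (\<Sum>i\<le>k. C * ((-1) ^ i * (k choose i) * pochhammer (\<alpha> + i) d))"
    using inner by (intro sum.cong) auto
  also have "\<dots> = 0"
    unfolding sum_distrib_left[symmetric] using alternating_binomial_pochhammer[OF \<open>d < k\<close>, of \<alpha>] by simp
  finally show ?thesis .
qed

text \<open>The kernel is a multiple of \<open>alternating k\<close> and the test function is a
  polynomial in \<open>s\<close> of degree at most \<open>k - 1\<close>, so the previous lemma
  applies term by term.\<close>

lemma degenerate_imp_orthogonal:
  assumes polya: "polya \<alpha> \<beta>" "\<alpha> > 0" "\<beta> > 0" and k: "1 \<le> k" "k \<le> n" and deg: "degenerate_kernel k \<phi>"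
  shows "orthogonal_kernel n k \<phi>"
  unfolding orthogonal_kernel_def
proof
  fix \<psi>
  obtain c where c: "\<And>s. s \<le> n \<Longrightarrow> u_sum n (k - 1) \<psi> s = (\<Sum>e\<le>k - 1. c e * pochhammer (\<alpha> + real s) e)"
    using pochhammer_span_u_sum[of \<alpha> n "k - 1" \<psi>] unfolding pochhammer_span_def by blast
  define D where "D = \<phi> 0 * a 0 k"
  have \<phi>_eq: "\<phi> i = D * alternating k i" if "i \<le> k" for i
    unfolding D_def by (rule degenerate_eq_alternating[OF deg that])
  have u: "u_sum n k \<phi> s = D * u_sum n k (alternating k) s" for s
  proof -
    have "u_sum n k \<phi> s = (\<Sum>i\<le>k. real (s choose i) * real ((n - s) choose (k - i)) * (D * alternating k i))"
      unfolding u_sum_def by (intro sum.cong refl) (simp add: \<phi>_eq)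
    then show ?thesis by (simp add: u_sum_def sum_distrib_left mult_ac)
  qed
  have "(\<Sum>s\<le>n. real (n choose s) * a s (n - s) * (u_sum n k \<phi> s * u_sum n (k - 1) \<psi> s)) =
    (\<Sum>s\<le>n. \<Sum>e\<le>k - 1. D * c e * (real (n choose s) * a s (n - s) * (u_sum n k (alternating k) s * pochhammer (\<alpha> + s) e)))"
    by (intro sum.cong refl) (simp add: u c[unfolded One_nat_def] sum_distrib_left mult_ac)
  also have "\<dots> = (\<Sum>e\<le>k - 1. D * c e * (\<Sum>s\<le>n. real (n choose s) * a s (n - s) * (u_sum n k (alternating k) s * pochhammer (\<alpha> + s) e)))"
    by (subst sum.swap) (simp add: sum_distrib_left)
  also have "\<dots> = 0"
    using k by (intro sum.neutral) (auto simp: u_sum_alternating_orthogonal[OF polya])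
  finally show "(\<Sum>s\<le>n. real (n choose s) * a s (n - s) * (u_sum n k \<phi> s * u_sum n (k - 1) \<psi> s)) = 0" .
qed

text \<open>Every kernel is a multiple of \<open>alternating k\<close> plus a lifted kernel. If it
  is orthogonal to order \<open>k - 1\<close>, so is the lifted part, which itself represents a
  statistic of that order and hence vanishes.\<close>

lemma orthogonal_imp_degenerate:
  assumes alt_orth: "orthogonal_kernel n k (alternating k)" and k: "1 \<le> k" "k \<le> n"
    and orth: "orthogonal_kernel n k \<phi>"
  shows "degenerate_kernel k \<phi>"
proof -
  define L where "L \<phi> = (\<Sum>l\<le>k. (-1) ^ l * (k choose l) * \<phi> l)" for \<phi> :: "nat \<Rightarrow> real"
  have "L (alternating k) = (\<Sum>l\<le>k. (k choose l) / a l (k - l))"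
    unfolding L_def alternating_def by (intro sum.cong) (auto simp: power_add[symmetric])
  also have "\<dots> > 0" using a_pos by (intro sum_pos) auto
  finally have Lpos: "L (alternating k) > 0" .
  \<comment> \<open>Chosen so that the alternating sum \<open>L\<close> of the remainder
    \<open>\<eta>\<close> is zero, which makes \<open>\<eta>\<close> a lifted kernel. The division
    is allowed because the signs in \<open>L (alternating k)\<close> cancel.\<close>
  define c where "c = L \<phi> / L (alternating k)"
  define \<eta> where "\<eta> i = \<phi> i - c * alternating k i" for i
  have "L \<eta> = L \<phi> - c * L (alternating k)"
    by (simp add: L_def \<eta>_def algebra_simps sum_subtractf sum_distrib_left)
  then have "L \<eta> = 0" using Lpos by (simp add: c_def)
  then obtain \<psi> where \<psi>: "\<And>i. i \<le> k \<Longrightarrow> lift_kernel k \<psi> i = \<eta> i"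
    using lift_kernel_surj[OF k(1), of \<eta>] by (auto simp: L_def)
  define N where "N = real (n - k + 1)"
  have u\<eta>: "u_sum n k \<eta> s = N * u_sum n (k - 1) \<psi> s" if "s \<le> n" for s
  proof -
    have "u_sum n k \<eta> s = u_sum n k (lift_kernel k \<psi>) s" by (simp add: u_sum_def \<psi>)
    then show ?thesis using u_sum_lift[OF k that, of \<psi>] by (simp add: N_def)
  qed
  have u\<eta>': "u_sum n k \<eta> s = u_sum n k \<phi> s - c * u_sum n k (alternating k) s" for s
    by (simp add: u_sum_def \<eta>_def algebra_simps sum_subtractf sum_distrib_left)
  \<comment> \<open>Test against \<open>\<psi>\<close> itself: since \<open>u_sum n k \<eta>\<close>
    is a positive multiple of \<open>u_sum n (k - 1) \<psi>\<close>, the result is a weighted sum of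
    squares.\<close>
  have "(\<Sum>s\<le>n. real (n choose s) * a s (n - s) * (u_sum n k \<eta> s * u_sum n (k - 1) \<psi> s)) = 
     (\<Sum>s\<le>n. real (n choose s) * a s (n - s) * (u_sum n k \<phi> s * u_sum n (k - 1) \<psi> s)) -
     c * (\<Sum>s\<le>n. real (n choose s) * a s (n - s) * (u_sum n k (alternating k) s * u_sum n (k - 1) \<psi> s))"
    by (simp add: u\<eta>' algebra_simps sum_subtractf sum_distrib_left)
  also have "\<dots> = 0" using orth alt_orth by (simp add: orthogonal_kernel_def)
  finally have "(\<Sum>s\<le>n. real (n choose s) * a s (n - s) * (N * (u_sum n (k - 1) \<psi> s * u_sum n (k - 1) \<psi> s))) = 0"
    by (simp add: u\<eta> mult.assoc)
  moreover have "\<forall>s\<in>{..n}. real (n choose s) * a s (n - s) * (N * (u_sum n (k - 1) \<psi> s * u_sum n (k - 1) \<psi> s)) \<ge> 0"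
    using a_pos by (auto simp: N_def less_imp_le)
  ultimately have "\<forall>s\<in>{..n}. real (n choose s) * a s (n - s) * (N * (u_sum n (k - 1) \<psi> s * u_sum n (k - 1) \<psi> s)) = 0"
    by (subst (asm) sum_nonneg_eq_0_iff) auto
  moreover have "real (n choose s) \<noteq> 0" "a s (n - s) \<noteq> 0" "N \<noteq> 0" if "s \<le> n" for s
    using that a_pos[of s "n - s"] by (auto simp: N_def)
  ultimately have "u_sum n (k - 1) \<psi> s = 0" if "s \<le> n" for s
    using that by fastforce
  then have \<psi>0: "\<psi> i = 0" if "i \<le> k - 1" for i
    using u_sum_inj[of n "k - 1" \<psi> i] that k by auto
  have "\<phi> i = c * alternating k i" if "i \<le> k" for i
  proof -
    have "\<eta> i = 0"
      unfolding \<psi>[OF that, symmetric] lift_kernel_def using \<psi>0[of "i - 1"] \<psi>0[of i] that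
      by (cases "i = k") auto
    then show ?thesis by (simp add: \<eta>_def)
  qed
  then show ?thesis by (rule degenerate_kernel_scale)
qed

lemma polya_imp_decomposable:
  assumes polya: "polya \<alpha> \<beta>" "\<alpha> > 0" "\<beta> > 0"
  shows decomposable
  unfolding decomposable_def
proof (intro allI impI ballI iffI)
  fix n k :: nat and \<phi> assume "2 \<le> n" "k \<in> {1..n}"
  then have k: "1 \<le> k" "k \<le> n" by auto
  show "orthogonal_kernel n k \<phi>" if "degenerate_kernel k \<phi>"
    using degenerate_imp_orthogonal[OF polya k that] .
  show "degenerate_kernel k \<phi>" if "orthogonal_kernel n k \<phi>"
    using orthogonal_imp_degenerate[OF degenerate_imp_orthogonal[OF polya k degenerate_alternating] k that] .
qed

text \<open>Apply decomposability with \<open>n = k + 1\<close> to \<open>alternating k\<close>.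
  Testing against the indicator kernels of order \<open>k - 1\<close> gives three-term relations
  along the diagonal \<open>i + j = k\<close>.\<close>

lemma decomposable_second_difference:
  assumes decomposable "t + 2 \<le> k"
  shows "up t (k - t) - 2 * up (t + 1) (k - (t + 1)) + up (t + 2) (k - (t + 2)) = 0"
proof -
  define p where "p s = up s (k - s)" for s
  define h where "h s = (real k + 1 - s) * p s + s * p (s - 1)" for s :: nat
  define W where "W s = a s (Suc k - s) * u_sum (Suc k) k (alternating k) s" for s
  have k: "k \<ge> 2" using assms by simp
  have W: "W s = (-1) ^ s * (real k + 1 - s - h s)" if "s \<le> Suc k" for s
  proof -
    \<comment> \<open>A \<open>k\<close>-subset of \<open>k + 1\<close> positions omits just one, so
      this U-statistic is the lifted kernel itself.\<close>
    have "u_sum (Suc k) k (alternating k) s = lift_kernel (Suc k) (alternating k) s"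
      using u_sum_lift[of "Suc k" "Suc k" s "alternating k"] u_sum_full[of s "Suc k"] that by simp
    then have W_eq: "W s = s * (a s (Suc k - s) * alternating k (s - 1)) +
        real (Suc k - s) * (a s (Suc k - s) * alternating k s)"
      by (simp add: W_def lift_kernel_def algebra_simps)
    have left: "s * (a s (Suc k - s) * alternating k (s - 1)) = - ((-1) ^ s * (s * p (s - 1)))"
    proof (cases s)
      case (Suc j)
      then show ?thesis using a_pos[of j "k - j"] by (simp add: alternating_def p_def a_Suc_left)
    qed simp
    have right: "real (Suc k - s) * (a s (Suc k - s) * alternating k s) = (-1) ^ s * ((real k + 1 - s) * (1 - p s))"
    proof (cases "s = Suc k")
      case False
      then have s: "s \<le> k" using that by simp
      then have "a s (Suc k - s) * alternating k s = (-1) ^ s * (1 - p s)"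
        using a_pos[of s "k - s"] by (simp add: alternating_def p_def Suc_diff_le a_Suc_right)
      then show ?thesis using s by (simp add: of_nat_diff)
    qed simp
    show ?thesis unfolding W_eq left right h_def by (simp add: algebra_simps)
  qed
  have orth: "orthogonal_kernel (Suc k) k (alternating k)"
    using assms(1) k degenerate_alternating[of k] by (simp add: decomposable_def)
  have W_sum: "W t + 2 * W (t + 1) + W (t + 2) = 0" if "t < k" for t
  proof -
    \<comment> \<open>With the indicator of \<open>t\<close> as test kernel,
      \<open>binomial_reindex\<close> leaves only \<open>s = t\<close>, \<open>t + 1\<close>,
      \<open>t + 2\<close>, with weights \<open>1\<close>, \<open>2\<close>,
      \<open>1\<close>.\<close>
    define \<delta> :: "nat \<Rightarrow> real" where "\<delta> j = (if j = t then 1 else 0)" for j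
    have t: "t \<le> k - Suc 0" "t \<le> k - 1" "k - 1 \<le> Suc k" "Suc k - (k - 1) = 2" using that k by auto
    have u\<delta>: "u_sum (Suc k) (k - 1) \<delta> s = real (s choose t) * real ((Suc k - s) choose (k - 1 - t))" for s
      using t by (simp add: u_sum_def \<delta>_def if_distrib cong: if_cong)
    have "0 = (\<Sum>s\<le>Suc k. real (Suc k choose s) * a s (Suc k - s) *
        (u_sum (Suc k) k (alternating k) s * u_sum (Suc k) (k - 1) \<delta> s))"
      using orth unfolding orthogonal_kernel_def by simp
    also have "\<dots> = (\<Sum>s\<le>Suc k. real (Suc k choose s) * real (s choose t) * real ((Suc k - s) choose (k - 1 - t)) * W s)"
      unfolding u\<delta> by (intro sum.cong refl) (simp add: W_def mult_ac)
    also have "\<dots> = real (Suc k choose (k - 1)) * real ((k - 1) choose t) *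
        (\<Sum>r\<le>2. real (2 choose r) * W (t + r))"
      using binomial_reindex[OF t(2,3), of W] unfolding t(4) .
    finally have "(\<Sum>r\<le>2. real (2 choose r) * W (t + r)) = 0" using t by simp
    then show ?thesis by (simp add: numeral_2_eq_2)
  qed
  \<comment> \<open>The signs in \<open>W\<close> turn the weights \<open>1, 2, 1\<close> into a
    second difference, which kills the affine part \<open>k + 1 - s\<close>.\<close>
  have h: "h t - 2 * h (t + 1) + h (t + 2) = 0" if "t < k" for t
  proof -
    have "(-1) ^ t * (h t - 2 * h (t + 1) + h (t + 2)) = - (W t + 2 * W (t + 1) + W (t + 2))"
      using that by (simp add: W algebra_simps)
    then have "(-1) ^ t * (h t - 2 * h (t + 1) + h (t + 2)) = 0" unfolding W_sum[OF that] by simp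
    then show ?thesis by (metis mult_eq_0_iff power_eq_0_iff zero_neq_neg_one)
  qed
  have "p t - 2 * p (t + 1) + p (t + 2) = 0"
    using assms(2)
  proof (induction t)
    case 0
    have "(real k - 1) * (p 0 - 2 * p 1 + p 2) = 0"
      using h[of 0] 0 by (simp add: h_def numeral_2_eq_2 algebra_simps)
    then show ?case using 0 by (simp add: numeral_2_eq_2)
  next
    case (Suc t)
    \<comment> \<open>The second difference of \<open>h\<close> combines those of \<open>p\<close>
      at \<open>Suc t\<close> and at \<open>t\<close>. The latter vanishes by induction, and the
      coefficient of the former is nonzero because \<open>Suc t + 2 \<le> k\<close>.\<close>
    have "(real k - 1 - Suc t) * (p (Suc t) - 2 * p (Suc t + 1) + p (Suc t + 2)) +
        Suc t * (p t - 2 * p (t + 1) + p (t + 2)) = 0"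
      using h[of "Suc t"] Suc.prems by (simp add: h_def algebra_simps)
    then show ?case using Suc by simp
  qed
  then show ?thesis by (simp add: p_def)
qed

lemma decomposable_affine:
  assumes decomposable "s \<le> k"
  shows "up s (k - s) = up 0 k + s * (up 1 (k - 1) - up 0 k)"
  using assms(2)
proof (induction s rule: less_induct)
  case (less s)
  consider "s = 0" | "s = 1" | t where "s = t + 2"
    by (cases s; cases "s - 1") auto
  then show ?case
  proof cases
    case 3
    have "up s (k - s) = 2 * up (t + 1) (k - (t + 1)) - up t (k - t)"
      using decomposable_second_difference[OF assms(1), of t k] less.prems 3 by simp
    then show ?thesis using less.IH[of t] less.IH[of "t + 1"] less.prems 3
      by (simp add: algebra_simps)
  qed auto
qed

text \<open>Each diagonal has two parameters, the intercept \<open>A k\<close> and the slope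
  \<open>B k\<close>. \<open>c1\<close> and \<open>c2\<close> determine those of the diagonal
  \<open>1\<close>, and the martingale equation at two points passes from one diagonal to the
  next.\<close>

lemma decomposable_imp_polya:
  assumes dec: decomposable and c1: "a 1 0 = c1" and c2: "a 2 0 = c2"
    and c: "0 < c1" "c1\<^sup>2 < c2" "c2 < c1" "c1 < 1"
  shows "polya (c1 * (c1 - c2) / (c2 - c1\<^sup>2)) ((1 - c1) * (c1 - c2) / (c2 - c1\<^sup>2))"
proof -
  define \<alpha> where "\<alpha> = c1 * (c1 - c2) / (c2 - c1\<^sup>2)"
  define \<beta> where "\<beta> = (1 - c1) * (c1 - c2) / (c2 - c1\<^sup>2)"
  define A where "A k = up 0 k" for k
  define B where "B k = up 1 (k - 1) - up 0 k" for k
  have up_eq: "up s (k - s) = A k + s * B k" if "s \<le> k" for s k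
    using decomposable_affine[OF dec that] by (simp add: A_def B_def)
  have \<alpha>\<beta>: "\<alpha> > 0" "\<beta> > 0" using c by (auto simp: \<alpha>_def \<beta>_def)
  have sum_eq: "\<alpha> + \<beta> = (c1 - c2) / (c2 - c1\<^sup>2)"
    by (simp add: \<alpha>_def \<beta>_def add_divide_distrib[symmetric] algebra_simps)
  have up00: "up 0 0 = c1" using a_00 c1 by (simp add: up_def)
  have a01: "a 0 1 = 1 - c1" using a_merge[of 0 0] unfolding One_nat_def[symmetric] a_00 c1 by simp
  have a11: "a 1 1 = c1 - c2" using a_merge[of 1 0] unfolding Suc_1 One_nat_def[symmetric] c1 c2 by simp
  have up01: "up 0 1 = (c1 - c2) / (1 - c1)" using a01 a11 by (simp add: up_def)
  have up10: "up 1 0 = c2 / c1" using c1 c2 by (simp add: up_def numeral_2_eq_2)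
  have B1: "B 1 * (\<alpha> + \<beta> + 1) = 1"
    using c unfolding B_def sum_eq up10 up01 
    by (simp add: up01[simplified] up10[simplified] divide_simps power2_eq_square) (simp add: algebra_simps)
  have A1: "A 1 * (\<alpha> + \<beta> + 1) = \<alpha>"
    using c unfolding A_def sum_eq unfolding \<alpha>_def
    by (simp add: up01[simplified] divide_simps power2_eq_square) (simp add: algebra_simps)
  have "A k * (\<alpha> + \<beta> + k) = \<alpha> \<and> B k * (\<alpha> + \<beta> + k) = 1" if "k \<ge> 1" for k
    using that
  proof (induction k rule: dec_induct)
    case base
    then show ?case using A1 B1 by simp
  next
    case (step k)
    define S where "S = \<alpha> + \<beta> + k"
    have S: "S > 0" using \<alpha>\<beta> by (simp add: S_def)
    have ups: "up 0 k = A k" "up 1 (k - 1) = A k + B k" "up 0 (Suc k) = A (Suc k)"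
       "up (Suc 0) k = A (Suc k) + B (Suc k)" "up (Suc 1) (k - 1) = A (Suc k) + 2 * B (Suc k)"
      using up_eq[of 0 k] up_eq[of 1 k] up_eq[of 0 "Suc k"] up_eq[of 1 "Suc k"] up_eq[of 2 "Suc k"] step.hyps
      by (auto simp: numeral_2_eq_2)
    have 0: "A k = A k * (A (Suc k) + B (Suc k)) + (1 - A k) * A (Suc k)"
      using up_harmonic[of 0 k] unfolding ups .
    have 1: "A k + B k = (A k + B k) * (A (Suc k) + 2 * B (Suc k)) + (1 - (A k + B k)) * (A (Suc k) + B (Suc k))"
      using up_harmonic[of 1 "k - 1"] step.hyps ups by simp
    \<comment> \<open>The difference of the two martingale equations: a recursion in the slope
      alone, solved by \<open>1 / (\<alpha> + \<beta> + k)\<close>.\<close>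
    have "B k = B (Suc k) * (1 + B k)" using 0 1 by (simp add: algebra_simps)
    moreover have "B k = 1 / S" using step.IH S by (auto simp: S_def field_simps)
    ultimately have B: "B (Suc k) * (S + 1) = 1" using S by (simp add: field_simps)
    have "A (Suc k) = A k * (1 - B (Suc k))" using 0 by (simp add: algebra_simps)
    moreover have "A k * S = \<alpha>" using step.IH by (simp add: S_def)
    ultimately have A: "A (Suc k) * S = \<alpha> * (1 - B (Suc k))" by (simp add: mult_ac flip: \<open>A k * S = \<alpha>\<close>)
    have "A (Suc k) * S * (S + 1) = \<alpha> * (S + 1 - B (Suc k) * (S + 1))" unfolding A by (simp add: algebra_simps)
    then have "A (Suc k) * (S + 1) = \<alpha>" using S by (simp add: B)
    then show ?case using B by (simp add: S_def algebra_simps)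
  qed
  note AB = this
  have "up i j * (\<alpha> + \<beta> + i + j) = \<alpha> + i" for i j
  \<comment> \<open>The diagonal \<open>0\<close> has a single entry and lies outside the induction;
    there the rule is a relation for \<open>c1\<close>.\<close>
  proof (cases "i + j = 0")
    case True
    have "c1 * (\<alpha> + \<beta>) = \<alpha>" unfolding sum_eq by (simp add: \<alpha>_def)
    then show ?thesis using True by (simp add: up00)
  next
    case False
    then have "A (i + j) * (\<alpha> + \<beta> + (i + j)) = \<alpha>" "B (i + j) * (\<alpha> + \<beta> + (i + j)) = 1"
      using AB[of "i + j"] by auto
    then have "(A (i + j) + i * B (i + j)) * (\<alpha> + \<beta> + (i + j)) = \<alpha> + i"
      by (simp add: distrib_right mult.assoc)
    then show ?thesis using up_eq[of i "i + j"] by (simp add: add.assoc)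
  qed
  then show ?thesis by (simp add: polya_def \<alpha>_def \<beta>_def)
qed

end

section \<open>Urn functions\<close>

definition ratio :: "nat \<Rightarrow> nat \<Rightarrow> real" where
  "ratio x y = real x / (real x + real y)"

lemma ratio_scale: "k > 0 \<Longrightarrow> ratio (k * x) (k * y) = ratio x y"
  by (simp add: ratio_def distrib_left[symmetric])

lemma ratio_swap: "x > 0 \<Longrightarrow> 1 - ratio x y = ratio y x"
  by (simp add: ratio_def divide_simps)

lemma ratio_in_Rats_01: "x > 0 \<Longrightarrow> y > 0 \<Longrightarrow> ratio x y \<in> \<rat> \<inter> {0 <..< 1}"
  by (auto simp: ratio_def)

text \<open>In odds \<open>t / (1 - t)\<close> the boundary \<open>ratio x y = t\<close> is a
  straight line, the form needed for counting lattice points.\<close>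

lemma ratio_less_iff:
  assumes "t < 1" "y > 0" shows "ratio x y < t \<longleftrightarrow> x < t / (1 - t) * y"
  using assms by (simp add: ratio_def divide_simps) (simp add: algebra_simps)

lemma less_ratio_iff:
  assumes "t < 1" "y > 0" shows "t < ratio x y \<longleftrightarrow> t / (1 - t) * y < x"
  using assms by (simp add: ratio_def divide_simps) (simp add: algebra_simps)

text \<open>Multiplying both counts by \<open>Suc K\<close> keeps the ratio, so a rational
  proportion is realised by arbitrarily large urns.\<close>

lemma Rats_01_ratioE:
  assumes "z \<in> \<rat> \<inter> {0 <..< 1}"
  obtains x y :: nat where "x \<ge> K" "y \<ge> K" "x > 0" "y > 0" "z = ratio x y"
proof -
  have z: "z > 0" "z < 1" "z \<in> \<rat>" using assms by auto
  from Rats_abs_nat_div_natE[OF z(3)] obtain m n :: nat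
    where mn: "n \<noteq> 0" "\<bar>z\<bar> = m / n" by metis
  have "real m / n < 1" using mn z by simp
  then have "real m < real n" using mn(1) by (simp add: divide_less_eq)
  then have m: "m > 0" "m < n" using mn z by (auto intro!: Nat.gr0I)
  then have "z = ratio m (n - m)"
    using mn z by (simp add: ratio_def of_nat_diff)
  then have eq: "z = ratio (Suc K * m) (Suc K * (n - m))" by (subst ratio_scale) auto
  have ge: "K * 1 \<le> Suc K * m" "K * 1 \<le> Suc K * (n - m)"
    using m by (intro mult_le_mono; simp)+
  have "Suc K * m > 0" "Suc K * (n - m) > 0" using m by simp_all
  then show ?thesis by (rule that[OF ge[unfolded mult_1_right] _ _ eq])
qed

text \<open>The predictive probability depends on the urn only through its proportion. The bound
  \<open>K\<close> leaves room for the initial balls of an actual urn process.\<close>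

locale homogeneous_urn =
  fixes f :: "real \<Rightarrow> real" and K :: nat
  assumes K_pos: "K > 0"
    and f_pos: "\<And>x y. x \<ge> K \<Longrightarrow> y \<ge> K \<Longrightarrow> 0 < f (ratio x y)"
    and f_less_1: "\<And>x y. x \<ge> K \<Longrightarrow> y \<ge> K \<Longrightarrow> f (ratio x y) < 1"
    and f_step: "\<And>x y. x \<ge> K \<Longrightarrow> y \<ge> K \<Longrightarrow> f (ratio x y) \<le> f (ratio (Suc x) y)"
    and f_harmonic: "\<And>x y. x \<ge> K \<Longrightarrow> y \<ge> K \<Longrightarrow>
      f (ratio x y) = f (ratio x y) * f (ratio (Suc x) y) + (1 - f (ratio x y)) * f (ratio x (Suc y))"
begin

abbreviation "Q01 \<equiv> \<rat> \<inter> {0 <..< 1 :: real}"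

lemma f_Q01: assumes "z \<in> Q01" shows "0 < f z" "f z < 1"
  using Rats_01_ratioE[OF assms, of K] f_pos f_less_1 by metis+

text \<open>\<open>f (ratio x y)\<close> is a weighted average of two neighbours. As the one on the
  right is not smaller, the other is not larger.\<close>

lemma f_step_left:
  assumes "x \<ge> K" "y \<ge> K" shows "f (ratio x (Suc y)) \<le> f (ratio x y)"
proof -
  let ?p = "f (ratio x y)"
  have "?p * ?p \<le> ?p * f (ratio (Suc x) y)"
    using f_step[OF assms] f_pos[OF assms] by (intro mult_left_mono) auto
  then have "(1 - ?p) * f (ratio x (Suc y)) \<le> (1 - ?p) * ?p"
    using f_harmonic[OF assms] by (simp add: algebra_simps)
  then show ?thesis using f_less_1[OF assms] by simp
qed

text \<open>Give both ratios the common second count \<open>y' * y\<close>, then add ones singly and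
  apply \<open>f_step\<close>.\<close>

lemma f_mono: assumes "z \<in> Q01" "z' \<in> Q01" "z \<le> z'" shows "f z \<le> f z'"
proof -
  obtain x y where z: "x \<ge> K" "y \<ge> K" "x > 0" "y > 0" "z = ratio x y"
    using Rats_01_ratioE[OF assms(1)] .
  obtain x' y' where z': "x' \<ge> K" "y' \<ge> K" "x' > 0" "y' > 0" "z' = ratio x' y'"
    using Rats_01_ratioE[OF assms(2)] .
  have eqz: "z = ratio (y' * x) (y' * y)" "z' = ratio (y * x') (y' * y)"
    using z z' ratio_scale[of y' x y] ratio_scale[of y x' y'] by (auto simp: mult.commute)
  have "real (y' * x) \<le> real (y * x')"
    using assms(3) z z' by (simp add: ratio_def divide_simps) (simp add: algebra_simps)
  then have le: "y' * x \<le> y * x'" using of_nat_le_iff by blast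
  have K1: "y' * x \<ge> K" "y' * y \<ge> K" using z z'
    by (metis Suc_leI mult_le_mono nat_mult_1 One_nat_def)+
  have "f (ratio (y' * x) (y' * y)) \<le> f (ratio (y' * x + d) (y' * y))" for d
  proof (induction d)
    case (Suc d)
    have "f (ratio (y' * x + d) (y' * y)) \<le> f (ratio (Suc (y' * x + d)) (y' * y))"
      by (rule f_step) (use K1 in auto)
    with Suc show ?case by simp
  qed simp
  from this[of "y * x' - y' * x"] show ?thesis using le by (simp add: eqz)
qed

text \<open>Chernoff's argument: at \<open>w = w0\<close> the left side has value \<open>1\<close>
  and slope \<open>c - w0 < 0\<close> at \<open>l = 0\<close>, so it falls below \<open>1\<close>
  for a small positive \<open>l\<close>. It is affine and nonincreasing in \<open>w\<close>, which
  covers larger \<open>w\<close>.\<close>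

lemma exponential_tilt:
  fixes c w0 :: real assumes "c < w0"
  obtains l where "l > 0" "\<And>w. w \<ge> w0 \<Longrightarrow> w * exp (- (l * (1 - c))) + (1 - w) * exp (l * c) \<le> 1"
proof -
  let ?h = "\<lambda>l. w0 * exp (- (l * (1 - c))) + (1 - w0) * exp (l * c)"
  have "(?h has_real_derivative (c - w0)) (at 0)"
    by (auto intro!: derivative_eq_intros simp: algebra_simps)
  from DERIV_neg_dec_right[OF this] obtain d where d: "d > 0" "\<And>h. 0 < h \<Longrightarrow> h < d \<Longrightarrow> ?h (0 + h) < ?h 0"
    using assms by force
  have h: "?h (d/2) < 1" using d(2)[of "d/2"] d(1) by simp
  show ?thesis
  proof (rule that[of "d/2"])
    show "d/2 > 0" using d by simp
    fix w assume w: "w \<ge> w0"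
    have "d/2 * (1 - c) + d/2 * c = d/2" by (simp add: field_simps)
    then have "exp (- (d/2 * (1 - c))) \<le> exp (d/2 * c)" using d by simp
    then have "w * (exp (- (d/2 * (1 - c))) - exp (d/2 * c)) \<le> w0 * (exp (- (d/2 * (1 - c))) - exp (d/2 * c))"
      using w by (intro mult_right_mono_neg) auto
    then show "w * exp (- (d/2 * (1 - c))) + (1 - w) * exp (d/2 * c) \<le> 1"
      using h by (simp add: algebra_simps)
  qed
qed

text \<open>The gap \<open>f z2 - f (ratio x y)\<close> averages exactly over the next draw and
  \<open>G\<close> does not increase on average while the proportion exceeds \<open>z0\<close>.
  Backward induction from a far horizon compares them: where the induction stops, the gap is at most
  \<open>0\<close> or \<open>G\<close> is at least \<open>1\<close>.\<close>

lemma overshoot_bound: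
  fixes n0 x0 y0 :: nat and z0 z2 c l :: real
  assumes z0: "z0 \<in> Q01" and z2: "z2 \<in> Q01" and "z0 < z2" "z2 < c" "c < f z0"
    and l: "l > 0" "\<And>w. w \<ge> f z0 \<Longrightarrow> w * exp (- (l * (1 - c))) + (1 - w) * exp (l * c) \<le> 1"
    and K0: "x0 \<ge> K" "y0 \<ge> K" and n0: "n0 = x0 + y0"
  shows "f z2 - f (ratio x0 y0) \<le> exp (- (l * (x0 - z0 * n0)))"
proof -
  \<comment> \<open>The constant \<open>(c - z0) * n0\<close> makes \<open>G\<close> at least
    \<open>1\<close> whenever the proportion is at most \<open>z0\<close> at a total of
    \<open>n0\<close> or more, and gives the claimed bound at the start.\<close>
  define G where "G x y = exp (- (l * (real x - c * (real x + real y) + (c - z0) * n0)))" for x y :: nat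
  \<comment> \<open>At so late a horizon, a proportion below \<open>z2\<close> already forces
    \<open>G\<close> to be at least \<open>1\<close>.\<close>
  obtain N0 :: nat where N0: "(c - z0) * n0 / (c - z2) \<le> N0" using real_arch_simple by blast
  define N where "N = max N0 n0"
  have N: "(c - z0) * n0 \<le> (c - z2) * N" "N \<ge> n0"
  proof -
    have "(c - z0) * n0 / (c - z2) \<le> N" using N0 by (simp add: N_def)
    then show "(c - z0) * n0 \<le> (c - z2) * N" using assms by (simp add: divide_simps mult.commute)
  qed (simp add: N_def)
  have claim: "f z2 - f (ratio x y) \<le> G x y"
    if "x \<ge> x0" "y \<ge> y0" "x + y \<le> N" "N - (x + y) = m" for x y m
    using that
  proof (induction m arbitrary: x y)
    case base: 0
    have xy: "x > 0" "y > 0" using base.prems K0 K_pos by auto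
    have Q: "ratio x y \<in> Q01" using ratio_in_Rats_01[OF xy] .
    have NN: "real x + real y = N" using base.prems by linarith
    show ?case
    proof (cases "ratio x y \<ge> z2")
      case True
      then have "f z2 \<le> f (ratio x y)" using f_mono z2 Q by auto
      moreover have "G x y \<ge> 0" by (simp add: G_def)
      ultimately show ?thesis by simp
    next
      case False
      then have "x < z2 * (real x + real y)"
        using xy by (simp add: ratio_def divide_simps split: if_splits)
      then have "real x - c * (real x + real y) + (c - z0) * n0 \<le> 0"
        using N unfolding NN by (simp add: algebra_simps)
      then have "G x y \<ge> 1" unfolding G_def using l(1) by (simp add: mult_nonneg_nonpos)
      then show ?thesis using f_Q01[OF z2] f_Q01[OF Q] by linarith
    qed
  next
    case (Suc m)
    have xy: "x > 0" "y > 0" using Suc.prems K0 K_pos by auto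
    have xyK: "x \<ge> K" "y \<ge> K" using Suc.prems K0 by auto
    have Q: "ratio x y \<in> Q01" using ratio_in_Rats_01[OF xy] .
    show ?case
    proof (cases "ratio x y \<le> z0")
      case True
      then have "x \<le> z0 * (real x + real y)"
        using xy by (simp add: ratio_def divide_simps split: if_splits)
      moreover have "(c - z0) * n0 \<le> (c - z0) * (real x + real y)"
        using Suc.prems assms by (intro mult_left_mono) (auto simp: n0)
      ultimately have "real x - c * (real x + real y) + (c - z0) * n0 \<le> 0"
        by (simp add: algebra_simps)
      then have "G x y \<ge> 1" unfolding G_def using l(1) by (simp add: mult_nonneg_nonpos)
      then show ?thesis using f_Q01[OF z2] f_Q01[OF Q] by linarith
    next
      case False
      define p where "p = f (ratio x y)"
      have p: "p \<ge> f z0" "0 < p" "p < 1"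
        using f_mono[OF z0 Q] False f_Q01[OF Q] by (auto simp: p_def)
      have 1: "f z2 - f (ratio (Suc x) y) \<le> G (Suc x) y"
        using Suc.IH[of "Suc x" y] Suc.prems by simp
      have 2: "f z2 - f (ratio x (Suc y)) \<le> G x (Suc y)"
        using Suc.IH[of x "Suc y"] Suc.prems by simp
      have "p = p * f (ratio (Suc x) y) + (1 - p) * f (ratio x (Suc y))"
        using f_harmonic[OF xyK] by (simp only: p_def[symmetric])
      then have "f z2 - p = p * (f z2 - f (ratio (Suc x) y)) + (1 - p) * (f z2 - f (ratio x (Suc y)))"
        by (simp add: algebra_simps)
      also have "\<dots> \<le> p * G (Suc x) y + (1 - p) * G x (Suc y)"
        using p 1 2 by (intro add_mono mult_left_mono) auto
      also have "G (Suc x) y = G x y * exp (- (l * (1 - c)))"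
        by (simp add: G_def exp_add[symmetric] algebra_simps)
      also have "G x (Suc y) = G x y * exp (l * c)"
        by (simp add: G_def exp_add[symmetric] algebra_simps)
      also have "p * (G x y * exp (- (l * (1 - c)))) + (1 - p) * (G x y * exp (l * c)) =
        G x y * (p * exp (- (l * (1 - c))) + (1 - p) * exp (l * c))"
        by (simp add: algebra_simps)
      also have "\<dots> \<le> G x y * 1"
        using l(2)[OF p(1)] by (intro mult_left_mono) (auto simp: G_def)
      finally show ?thesis by (simp add: p_def)
    qed
  qed
  have "f z2 - f (ratio x0 y0) \<le> G x0 y0"
    using claim[of x0 y0] N by (auto simp: n0)
  also have "\<dots> = exp (- (l * (x0 - z0 * n0)))" by (simp add: G_def n0 algebra_simps)
  finally show ?thesis .
qed

text \<open>The urns \<open>(k * x, k * y)\<close> all have proportion \<open>z\<close>, while the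
  exponent in \<open>overshoot_bound\<close> grows linearly in \<open>k\<close>; hence
  \<open>f z2 - f z\<close> is at most \<open>0\<close>.\<close>

lemma constant_above:
  assumes z0: "z0 \<in> Q01" and z: "z \<in> Q01" and z2: "z2 \<in> Q01"
    and "z0 < z" "z \<le> z2" "z2 < f z0"
  shows "f z = f z2"
proof (rule antisym)
  show "f z \<le> f z2" using f_mono assms by blast
  obtain x y where xy: "x \<ge> K" "y \<ge> K" "x > 0" "y > 0" "z = ratio x y"
    using Rats_01_ratioE[OF z] .
  define c where "c = (z2 + f z0) / 2"
  have c: "z2 < c" "c < f z0" using assms by (auto simp: c_def)
  obtain l where l: "l > 0" "\<And>w. w \<ge> f z0 \<Longrightarrow> w * exp (- (l * (1 - c))) + (1 - w) * exp (l * c) \<le> 1"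
    using exponential_tilt[OF c(2)] by blast
  define d where "d = l * ((z - z0) * (x + y))"
  have d: "d > 0" using l assms xy by (auto simp: d_def)
  have x_eq: "real x = z * (x + y)" using xy by (simp add: ratio_def)
  have bound: "f z2 - f z \<le> exp (- d) ^ k" if "k > 0" for k :: nat
  proof -
    have "1 * K \<le> k * x" "1 * K \<le> k * y" using xy that by (intro mult_le_mono; simp)+
    then have kk: "k * x \<ge> K" "k * y \<ge> K" by simp_all
    have kx_eq: "real (k * x) = k * (z * (x + y))" by (simp only: x_eq[symmetric] of_nat_mult)
    have "f z2 - f (ratio (k * x) (k * y)) \<le> exp (- (l * (real (k * x) - z0 * real (k * x + k * y))))"
      using overshoot_bound[OF z0 z2 _ c l kk refl] assms by simp
    also have "ratio (k * x) (k * y) = z" using xy ratio_scale[OF that] by simp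
    also have "l * (real (k * x) - z0 * real (k * x + k * y)) = k * d"
    proof -
      have "real (k * x) - z0 * real (k * x + k * y) = k * ((z - z0) * (x + y))"
        using kx_eq by (simp add: algebra_simps)
      then show ?thesis by (simp add: d_def)
    qed
    finally show ?thesis by (simp add: exp_of_nat_mult[symmetric])
  qed
  have "(\<lambda>k. exp (- d) ^ k) \<longlonglongrightarrow> 0" using d by (intro LIMSEQ_realpow_zero) auto
  then have "f z2 - f z \<le> 0"
    by (rule LIMSEQ_le_const) (use bound in \<open>auto intro!: exI[of _ 1]\<close>)
  then show "f z2 \<le> f z" by simp
qed

text \<open>If constancy stopped at \<open>T < 1\<close>, take a lattice point just left of the line
  \<open>ratio x y = T\<close>. The martingale equation, solved for the neighbour on the right,
  carries the value \<open>c\<close> across this line.\<close>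

lemma constant_extends_right:
  assumes const: "\<And>z. z \<in> Q01 \<Longrightarrow> a < z \<Longrightarrow> z < b \<Longrightarrow> f z = c" and ab: "0 \<le> a" "a < b" "b \<le> 1"
    and z: "z \<in> Q01" "a < z"
  shows "f z = c"
proof (rule ccontr)
  assume neq: "f z \<noteq> c"
  define S where "S = {z \<in> Q01. a < z \<and> f z = c}"
  define T where "T = Sup S"
  have Q: "q \<in> Q01" if "q \<in> \<rat>" "a < q" "q < 1" for q using that ab by auto
  \<comment> \<open>If \<open>f\<close> took the value \<open>c\<close> at or beyond
    \<open>z\<close>, monotonicity would squeeze \<open>f z\<close> to \<open>c\<close>.\<close>
  have ltz: "s < z" if "s \<in> S" for s
  proof (rule ccontr)
    assume "\<not> s < z"
    then have le: "z \<le> s" by simp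
    obtain q where q: "q \<in> \<rat>" "a < q" "q < min b z" using Rats_dense_in_real[of a "min b z"] ab z by auto
    have "f q = c" "f s = c" "f q \<le> f z" "f z \<le> f s"
      using const[of q] Q[of q] q ab that z f_mono[of q z] f_mono[of z s] le by (auto simp: S_def)
    with neq show False by simp
  qed
  have bdd: "bdd_above S" using ltz by (meson bdd_above.I less_imp_le)
  have below_b: "b \<le> T"
  proof (rule field_le_epsilon)
    fix e :: real assume "e > 0"
    obtain q where q: "q \<in> \<rat>" "max a (b - e) < q" "q < b"
      using Rats_dense_in_real[of "max a (b - e)" b] ab \<open>e > 0\<close> by auto
    have "q \<in> S" using const[of q] Q[of q] q ab by (auto simp: S_def)
    then have "q \<le> T" unfolding T_def by (rule cSup_upper) (rule bdd)
    then show "b \<le> T + e" using q by simp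
  qed
  have Sne: "S \<noteq> {}"
  proof -
    obtain q where q: "q \<in> \<rat>" "a < q" "q < b" using Rats_dense_in_real[of a b] ab by auto
    then show ?thesis using const[of q] Q[of q] ab by (auto simp: S_def)
  qed
  have "T \<le> z" unfolding T_def using Sne ltz by (meson cSup_least less_imp_le)
  then have T: "a < T" "T < 1" "0 < T" using below_b ab z by auto
  have below_T: "f q = c" if q: "q \<in> Q01" "a < q" "q < T" for q
  proof -
    obtain s where s: "s \<in> S" "q < s" using q(3) unfolding T_def by (metis less_cSupE Sne)
    obtain r where r: "r \<in> \<rat>" "a < r" "r < min b q" using Rats_dense_in_real[of a "min b q"] ab q by auto
    have "f r = c" "f s = c" "f r \<le> f q" "f q \<le> f s"
      using const[of r] Q[of r] r ab q s f_mono[of r q] f_mono[of q s] by (auto simp: S_def)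
    then show ?thesis by simp
  qed
  define o_T where "o_T = T / (1 - T)"
  define o_a where "o_a = a / (1 - a)"
  have odds_less: "o_a < o_T" "0 \<le> o_a" using T ab by (auto simp: o_T_def o_a_def divide_simps algebra_simps)
  \<comment> \<open>The width of the strip between the odds \<open>o_a\<close> and
    \<open>o_T\<close> grows with \<open>y\<close>; here it accommodates all the lattice points used
    below, with first count at least \<open>K\<close>.\<close>
  obtain y :: nat where y: "y > (K + 3 + o_a) / (o_T - o_a) + K" using reals_Archimedean2 by blast
  have yK: "y \<ge> K"
  proof -
    have "(K + 3 + o_a) / (o_T - o_a) \<ge> 0" using odds_less by auto
    then have "real y > K" using y by linarith
    then show ?thesis by simp
  qed
  have ybig: "o_T * y > K + 3 + o_a * (y + 1)"
  proof -
    have "y > (K + 3 + o_a) / (o_T - o_a)" using y by linarith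
    then show ?thesis using odds_less by (simp add: divide_simps) (simp add: algebra_simps)
  qed
  \<comment> \<open>The last integer on or left of the line of odds \<open>o_T\<close> in row
    \<open>y\<close>. Since \<open>x'\<close> may lie on the line, the argument starts at
    \<open>x = x' - 1\<close> and takes two steps to the right.\<close>
  define x' where "x' = nat \<lfloor>o_T * y\<rfloor>"
  have oy: "o_T * y \<ge> 0" "o_a * (y + 1) \<ge> 0" using odds_less by auto
  then have x': "x' \<le> o_T * y" "o_T * y < x' + 1" unfolding x'_def by linarith+
  have "real x' > K + 2" using x' ybig oy by linarith
  then have "x' > K + 2" by linarith
  then obtain x where x: "x' = Suc x" "x \<ge> K" by (cases x') auto
  have ypos: "y > 0" "x > 0" using yK K_pos x by auto
  have in_range: "f (ratio i j) = c"
    if "i > 0" "j > 0" "i > o_a * j" "i < o_T * j" for i j :: nat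
    using that T ab ratio_in_Rats_01[of i j] below_T ratio_less_iff[of T j i] less_ratio_iff[of a j i]
    by (simp add: o_T_def o_a_def)
  have xlow: "x > o_a * (y + 1)" using x x' ybig oy by simp
  have xlow': "x > o_a * y" using xlow odds_less by (simp add: algebra_simps)
  have xup: "x < o_T * y" "x + 1 < o_T * (y + 1)"
    using x x' odds_less by (auto simp: algebra_simps)
  have xup': "x < o_T * (y + 1)" using xup by linarith
  have 1: "f (ratio x y) = c" "f (ratio x (Suc y)) = c"
    using in_range[of x y] in_range[of x "Suc y"] xlow xlow' xup xup' ypos by (auto simp: add.commute)
  have cpos: "c > 0" using 1 f_pos[of x y] x yK by auto
  \<comment> \<open>Two of the three values in the martingale equation equal \<open>c\<close>, and
    the remaining one has the nonzero weight \<open>c\<close>.\<close>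
  have 2: "f (ratio (Suc x) y) = c"
    using f_harmonic[of x y] 1 x yK cpos by (simp add: algebra_simps)
  have 3: "f (ratio (Suc x) (Suc y)) = c"
    using in_range[of "Suc x" "Suc y"] xlow xup ypos by (auto simp: add.commute)
  have 4: "f (ratio (Suc (Suc x)) y) = c"
    using f_harmonic[of "Suc x" y] 2 3 x yK cpos by (simp add: algebra_simps)
  have "real (Suc (Suc x)) > o_T * y" using x x' by simp
  then have 5: "ratio (Suc (Suc x)) y > T"
    using less_ratio_iff[of T y "Suc (Suc x)"] T ypos by (simp add: o_T_def)
  have "ratio (Suc (Suc x)) y \<in> S"
    using 4 5 T ratio_in_Rats_01[of "Suc (Suc x)" y] ypos by (auto simp: S_def)
  then have "ratio (Suc (Suc x)) y \<le> T" unfolding T_def by (rule cSup_upper) (rule bdd)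
  with 5 show False by simp
qed

text \<open>Exchange of the two colours. Monotonicity of the reflected function is
  \<open>f_step_left\<close>.\<close>

lemma reflected: "homogeneous_urn (\<lambda>z. 1 - f (1 - z)) K"
proof
  show "0 < K" by (rule K_pos)
next
  fix x y assume xy: "x \<ge> K" "y \<ge> K"
  then have swap: "1 - ratio x y = ratio y x" "1 - ratio (Suc x) y = ratio y (Suc x)"
      "1 - ratio x (Suc y) = ratio (Suc y) x"
    using K_pos by (auto simp: ratio_swap)
  show "0 < 1 - f (1 - ratio x y)" "1 - f (1 - ratio x y) < 1"
    using f_less_1[OF xy(2,1)] f_pos[OF xy(2,1)] by (auto simp: swap)
  show "1 - f (1 - ratio x y) \<le> 1 - f (1 - ratio (Suc x) y)"
    using f_step_left[OF xy(2,1)] by (simp add: swap)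
  show "1 - f (1 - ratio x y) = (1 - f (1 - ratio x y)) * (1 - f (1 - ratio (Suc x) y)) +
      (1 - (1 - f (1 - ratio x y))) * (1 - f (1 - ratio x (Suc y)))"
    unfolding swap using f_harmonic[OF xy(2,1)] by (simp add: algebra_simps)
qed

lemma constant_everywhere:
  assumes const: "\<And>z. z \<in> Q01 \<Longrightarrow> a < z \<Longrightarrow> z < b \<Longrightarrow> f z = c" and ab: "0 \<le> a" "a < b" "b \<le> 1"
    and z: "z \<in> Q01"
  shows "f z = c"
proof (cases "a < z")
  case True
  then show ?thesis using constant_extends_right[OF const ab z] by blast
next
  case False
  interpret refl: homogeneous_urn "\<lambda>z. 1 - f (1 - z)" K by (rule reflected)
  have "1 - f (1 - (1 - z)) = 1 - c"
  proof (rule refl.constant_extends_right[of "1 - b" "1 - a"])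
    fix q assume "q \<in> Q01" "1 - b < q" "q < 1 - a"
    then show "1 - f (1 - q) = 1 - c" using const[of "1 - q"] by auto
  qed (use False ab z in auto)
  then show ?thesis by simp
qed

text \<open>\<open>f\<close> is constant between \<open>z0\<close> and \<open>f z0\<close>, and
  constancy spreads in both directions. The rational \<open>q\<close> is a reference point for
  arguments on either side of it.\<close>

lemma constant_if_above:
  assumes z0: "z0 \<in> Q01" "z0 < f z0"
  shows "\<exists>c. \<forall>z\<in>Q01. f z = c"
proof -
  obtain q where q: "q \<in> \<rat>" "z0 < q" "q < f z0" using Rats_dense_in_real[OF z0(2)] by auto
  have qQ: "q \<in> Q01" using q z0 f_Q01[OF z0(1)] by auto
  have loc: "f z = f q" if "z \<in> Q01" "z0 < z" "z < f z0" for z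
  proof (cases "z \<le> q")
    case True
    show ?thesis by (rule constant_above[OF z0(1) that(1) qQ that(2) True q(3)])
  next
    case False
    then have "q \<le> z" by simp
    then show ?thesis by (rule constant_above[OF z0(1) qQ that(1) q(2) _ that(3), symmetric])
  qed
  have bounds: "0 \<le> z0" "f z0 \<le> 1" using z0 f_Q01[OF z0(1)] by auto
  have "f z = f q" if "z \<in> Q01" for z
    by (rule constant_everywhere[OF loc bounds(1) z0(2) bounds(2) that])
  then show ?thesis by blast
qed

text \<open>A point with \<open>f z > z\<close> forces constancy directly; a point with
  \<open>f z < z\<close> does so after reflection.\<close>

lemma identity_or_constant: "(\<forall>z\<in>Q01. f z = z) \<or> (\<exists>c. \<forall>z\<in>Q01. f z = c)"
proof (rule disjCI)
  assume nconst: "\<not> (\<exists>c. \<forall>z\<in>Q01. f z = c)"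
  interpret refl: homogeneous_urn "\<lambda>z. 1 - f (1 - z)" K by (rule reflected)
  show "\<forall>z\<in>Q01. f z = z"
  proof (rule ballI, rule ccontr)
    fix z assume z: "z \<in> Q01" "f z \<noteq> z"
    have zz: "1 - z \<in> Q01" using z by auto
    show False
    proof (cases "z < f z")
      case True
      then show ?thesis using constant_if_above[OF z(1)] nconst by simp
    next
      case False
      then have less: "1 - z < 1 - f (1 - (1 - z))" using z(2) by simp
      from refl.constant_if_above[OF zz less] obtain c where c: "\<And>q. q \<in> Q01 \<Longrightarrow> 1 - f (1 - q) = c" by blast
      have "f q = 1 - c" if "q \<in> Q01" for q using c[of "1 - q"] that by auto
      then show ?thesis using nconst by blast
    qed
  qed
qed

end

section \<open>Moments of the Beta distribution\<close>

lemma Beta_real_pos: "a > 0 \<Longrightarrow> b > 0 \<Longrightarrow> Beta a b > (0 :: real)"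
  by (simp add: Beta_def)

lemma nn_integral_beta_measure:
  assumes "\<alpha> > 0" "\<beta> > 0"
  shows "(\<integral>\<^sup>+\<theta>. ennreal (\<theta> ^ i * (1 - \<theta>) ^ j) \<partial>beta_measure \<alpha> \<beta>) =
    ennreal (Beta (\<alpha> + i) (\<beta> + j) / Beta \<alpha> \<beta>)"
proof -
  define f :: "real \<Rightarrow> real" where
    "f \<theta> = 1 / Beta \<alpha> \<beta> * (\<theta> powr (\<alpha> + i - 1) * (1 - \<theta>) powr (\<beta> + j - 1))" for \<theta>
  have B: "Beta \<alpha> \<beta> > 0" using assms by (rule Beta_real_pos)
  \<comment> \<open>At \<open>x = 0\<close> both sides are \<open>0\<close>, because
    \<open>0 powr y = 0\<close> for every \<open>y\<close>.\<close>
  have powr_shift: "x powr (a - 1) * x ^ m = x powr (a + m - 1)" if "x \<ge> 0" "a > 0" for x a :: real and m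
  proof (cases "x = 0")
    case False
    then show ?thesis using that by (simp add: powr_realpow[symmetric] powr_add[symmetric] algebra_simps)
  qed simp
  have pointwise: "ennreal (1 / Beta \<alpha> \<beta> * \<theta> powr (\<alpha> - 1) * (1 - \<theta>) powr (\<beta> - 1)) *
      ennreal (\<theta> ^ i * (1 - \<theta>) ^ j) = ennreal (f \<theta>)" if "\<theta> \<in> {0..1}" for \<theta>
  proof -
    have "ennreal (1 / Beta \<alpha> \<beta> * \<theta> powr (\<alpha> - 1) * (1 - \<theta>) powr (\<beta> - 1)) *
        ennreal (\<theta> ^ i * (1 - \<theta>) ^ j) =
      ennreal (1 / Beta \<alpha> \<beta> * ((\<theta> powr (\<alpha> - 1) * \<theta> ^ i) * ((1 - \<theta>) powr (\<beta> - 1) * (1 - \<theta>) ^ j)))"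
      using that B by (subst ennreal_mult[symmetric]) (auto simp: mult_ac)
    then show ?thesis
      using that assms powr_shift[of \<theta> \<alpha> i] powr_shift[of "1 - \<theta>" \<beta> j] by (simp add: f_def)
  qed
  have "(f has_integral 1 / Beta \<alpha> \<beta> * Beta (\<alpha> + i) (\<beta> + j)) {0..1}"
    unfolding f_def using has_integral_Beta_real[of "\<alpha> + i" "\<beta> + j"] assms
    by (intro has_integral_mult_right) simp
  then have I: "(\<integral>\<^sup>+\<theta>. indicator {0..1} \<theta> * f \<theta> \<partial>lborel) = 1 / Beta \<alpha> \<beta> * Beta (\<alpha> + i) (\<beta> + j)"
    by (rule nn_integral_has_integral_lebesgue[rotated]) (use B in \<open>auto simp: f_def\<close>)
  have "(\<integral>\<^sup>+\<theta>. ennreal (\<theta> ^ i * (1 - \<theta>) ^ j) \<partial>beta_measure \<alpha> \<beta>) =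
    (\<integral>\<^sup>+\<theta>. ennreal (1 / Beta \<alpha> \<beta> * \<theta> powr (\<alpha> - 1) * (1 - \<theta>) powr (\<beta> - 1)) *
      ennreal (\<theta> ^ i * (1 - \<theta>) ^ j) \<partial>restrict_space lborel {0..1})"
    unfolding beta_measure_def
    by (rule nn_integral_density; rule measurable_restrict_space1; measurable)
  also have "\<dots> = (\<integral>\<^sup>+\<theta>. ennreal (1 / Beta \<alpha> \<beta> * \<theta> powr (\<alpha> - 1) * (1 - \<theta>) powr (\<beta> - 1)) *
      ennreal (\<theta> ^ i * (1 - \<theta>) ^ j) * indicator {0..1} \<theta> \<partial>lborel)"
    by (intro nn_integral_restrict_space) simp
  also have "\<dots> = (\<integral>\<^sup>+\<theta>. ennreal (indicator {0..1} \<theta> * f \<theta>) \<partial>lborel)"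
  proof (rule nn_integral_cong)
    fix \<theta> :: real
    show "ennreal (1 / Beta \<alpha> \<beta> * \<theta> powr (\<alpha> - 1) * (1 - \<theta>) powr (\<beta> - 1)) *
      ennreal (\<theta> ^ i * (1 - \<theta>) ^ j) * indicator {0..1} \<theta> = ennreal (indicator {0..1} \<theta> * f \<theta>)"
      using pointwise[of \<theta>] by (cases "\<theta> \<in> {0..1}") (simp_all del: atLeastAtMost_iff)
  qed
  finally show ?thesis using I by simp
qed

lemma space_beta_measure: "space (beta_measure \<alpha> \<beta>) = {0..1}"
  and sets_beta_measure: "sets (beta_measure \<alpha> \<beta>) = sets (restrict_space borel {0..1})"
  by (simp_all add: beta_measure_def space_restrict_space cong: sets_restrict_space_cong)

lemma prob_space_beta_measure:
  assumes "\<alpha> > 0" "\<beta> > 0" shows "prob_space (beta_measure \<alpha> \<beta>)"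
proof
  have "emeasure (beta_measure \<alpha> \<beta>) (space (beta_measure \<alpha> \<beta>)) = (\<integral>\<^sup>+\<theta>. 1 \<partial>beta_measure \<alpha> \<beta>)" by simp
  also have "\<dots> = 1" using nn_integral_beta_measure[OF assms, of 0 0] Beta_real_pos[OF assms] by simp
  finally show "emeasure (beta_measure \<alpha> \<beta>) (space (beta_measure \<alpha> \<beta>)) = 1" .
qed

lemma borel_measurable_unit_interval:
  assumes "sets \<gamma> = sets (restrict_space borel {0..1})" "f \<in> borel_measurable borel"
  shows "f \<in> borel_measurable (\<gamma> :: real measure)"
  using measurable_restrict_space1[OF assms(2)] measurable_cong_sets[OF assms(1) refl] by blast

lemma integral_beta_measure:
  assumes "\<alpha> > 0" "\<beta> > 0"
  shows "(\<integral>\<theta>. \<theta> ^ i * (1 - \<theta>) ^ j \<partial>beta_measure \<alpha> \<beta>) = Beta (\<alpha> + i) (\<beta> + j) / Beta \<alpha> \<beta>"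
proof -
  have "(\<integral>\<theta>. \<theta> ^ i * (1 - \<theta>) ^ j \<partial>beta_measure \<alpha> \<beta>) =
      enn2real (\<integral>\<^sup>+\<theta>. ennreal (\<theta> ^ i * (1 - \<theta>) ^ j) \<partial>beta_measure \<alpha> \<beta>)"
  proof (rule integral_eq_nn_integral)
    show "AE \<theta> in beta_measure \<alpha> \<beta>. 0 \<le> \<theta> ^ i * (1 - \<theta>) ^ j"
      by (rule AE_I2) (simp add: space_beta_measure)
  qed (rule borel_measurable_unit_interval[OF sets_beta_measure], measurable)
  also have "\<dots> = Beta (\<alpha> + i) (\<beta> + j) / Beta \<alpha> \<beta>"
    using Beta_real_pos[OF assms] Beta_real_pos[of "\<alpha> + i" "\<beta> + j"] assms
    by (simp add: nn_integral_beta_measure)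
  finally show ?thesis .
qed

lemma Beta_pochhammer:
  fixes \<alpha> \<beta> :: real
  assumes "\<alpha> > 0" "\<beta> > 0"
  shows "Beta (\<alpha> + i) (\<beta> + j) / Beta \<alpha> \<beta> = pochhammer \<alpha> i * pochhammer \<beta> j / pochhammer (\<alpha> + \<beta>) (i + j)"
proof -
  have gam: "Gamma (x + n) = pochhammer x n * Gamma x" if "x > 0" for x :: real and n
  proof -
    have "x \<notin> \<int>\<^sub>\<le>\<^sub>0" using that by (auto elim!: nonpos_Ints_cases)
    then show ?thesis using pochhammer_Gamma[of x n] Gamma_real_pos[OF that] by simp
  qed
  have nz: "Gamma \<alpha> \<noteq> 0" "Gamma \<beta> \<noteq> 0" "Gamma (\<alpha> + \<beta>) \<noteq> 0" "pochhammer (\<alpha> + \<beta>) (i + j) \<noteq> 0"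
    using assms Gamma_real_pos[of \<alpha>] Gamma_real_pos[of \<beta>] Gamma_real_pos[of "\<alpha> + \<beta>"]
      pochhammer_pos[of "\<alpha> + \<beta>" "i + j"] by linarith+
  have "\<alpha> + i + (\<beta> + j) = \<alpha> + \<beta> + real (i + j)" by simp
  then show ?thesis using assms
    by (simp only: Beta_def gam add_pos_pos) (simp add: nz field_simps)
qed

section \<open>Symmetric functions of binary words\<close>

lemma binary_lists_Suc: "binary_lists (Suc n) = (#) 0 ` binary_lists n \<union> (#) 1 ` binary_lists n"
proof (intro set_eqI iffI)
  fix xs assume "xs \<in> binary_lists (Suc n)"
  then obtain x ys where "xs = x # ys" "x = 0 \<or> x = 1" "ys \<in> binary_lists n"
    by (cases xs) (auto simp: binary_lists_def)
  then show "xs \<in> (#) 0 ` binary_lists n \<union> (#) 1 ` binary_lists n" by auto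
qed (auto simp: binary_lists_def)

lemma binary_lists_0: "binary_lists 0 = {[]}"
  by (auto simp: binary_lists_def)

lemma finite_binary_lists [simp]: "finite (binary_lists n)"
  by (induction n) (simp_all add: binary_lists_0 binary_lists_Suc)

lemma sum_binary_lists_Suc:
  fixes G :: "nat list \<Rightarrow> real"
  shows "(\<Sum>xs\<in>binary_lists (Suc n). G xs) = (\<Sum>xs\<in>binary_lists n. G (0 # xs)) + (\<Sum>xs\<in>binary_lists n. G (1 # xs))"
proof -
  have "(\<Sum>xs\<in>binary_lists (Suc n). G xs) =
      (\<Sum>xs\<in>(#) 0 ` binary_lists n. G xs) + (\<Sum>xs\<in>(#) 1 ` binary_lists n. G xs)"
    unfolding binary_lists_Suc by (intro sum.union_disjoint) auto
  then show ?thesis by (simp add: sum.reindex)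
qed

lemma sum_binary_lists:
  fixes F :: "nat \<Rightarrow> real"
  shows "(\<Sum>xs\<in>binary_lists n. F (sum_list xs)) = (\<Sum>s\<le>n. real (n choose s) * F s)"
proof (induction n arbitrary: F)
  case 0
  then show ?case by (simp add: binary_lists_0)
next
  case (Suc n)
  have "(\<Sum>xs\<in>binary_lists (Suc n). F (sum_list xs)) =
      (\<Sum>s\<le>n. real (n choose s) * F s) + (\<Sum>s\<le>n. real (n choose s) * F (Suc s))"
    using Suc[of F] Suc[of "\<lambda>s. F (Suc s)"] by (simp add: sum_binary_lists_Suc)
  also have "(\<Sum>s\<le>n. real (n choose s) * F s) = (\<Sum>s\<le>Suc n. real (n choose s) * F s)" by simp
  also have "\<dots> = F 0 + (\<Sum>s\<le>n. real (n choose Suc s) * F (Suc s))"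
    by (subst sum.atMost_Suc_shift) simp
  also have "\<dots> + (\<Sum>s\<le>n. real (n choose s) * F (Suc s)) =
      F 0 + (\<Sum>s\<le>n. real (Suc n choose Suc s) * F (Suc s))"
    by (simp add: sum.distrib distrib_right)
  also have "\<dots> = (\<Sum>s\<le>Suc n. real (Suc n choose s) * F s)"
    by (subst sum.atMost_Suc_shift) simp
  finally show ?case .
qed

lemma sum_list_binary_le: "xs \<in> binary_lists n \<Longrightarrow> sum_list xs \<le> n"
proof (induction n arbitrary: xs)
  case (Suc n)
  then show ?case by (fastforce simp: binary_lists_Suc)
qed (simp add: binary_lists_0)

lemma mset_binary:
  assumes "xs \<in> binary_lists n"
  shows "mset xs = replicate_mset (sum_list xs) 1 + replicate_mset (n - sum_list xs) 0"
  using assms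
proof (induction n arbitrary: xs)
  case (Suc n)
  then obtain ys where ys: "ys \<in> binary_lists n" "xs = 0 # ys \<or> xs = 1 # ys" by (auto simp: binary_lists_Suc)
  then show ?case using Suc.IH[OF ys(1)] sum_list_binary_le[OF ys(1)] by (auto simp: Suc_diff_le)
qed (simp add: binary_lists_0)

definition binary_word :: "nat \<Rightarrow> nat \<Rightarrow> nat list" where
  "binary_word k i = replicate i 1 @ replicate (k - i) 0"

lemma sum_list_binary_word [simp]: "sum_list (binary_word k i) = i"
  by (simp add: binary_word_def sum_list_replicate)

lemma binary_word_in [simp]: "i \<le> k \<Longrightarrow> binary_word k i \<in> binary_lists k"
  by (auto simp: binary_word_def binary_lists_def)

text \<open>A binary word is a rearrangement of the standard word with equally many ones. Symmetric
  kernels thus become functions of \<open>i\<close>, the number of ones.\<close>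

lemma symmetric_kernel_eq:
  assumes "symmetric_kernel k \<phi>" "xs \<in> binary_lists k"
  shows "\<phi> xs = \<phi> (binary_word k (sum_list xs))"
proof -
  have "binary_word k (sum_list xs) \<in> binary_lists k" using sum_list_binary_le[OF assms(2)] by simp
  moreover from this have "mset xs = mset (binary_word k (sum_list xs))"
    using mset_binary assms(2) sum_list_binary_word by metis
  ultimately show ?thesis using assms unfolding symmetric_kernel_def by blast
qed

lemma symmetric_kernel_sum_list: "symmetric_kernel k (\<lambda>xs. \<phi> (sum_list xs))"
  unfolding symmetric_kernel_def by (metis sum_mset_sum_list)

text \<open>A subset \<open>J\<close> corresponds to the pair of its traces on \<open>Ones\<close>
  and \<open>Zeros\<close>.\<close>

lemma sum_subsets_split:
  fixes F :: "nat \<Rightarrow> real" and Ones Zeros :: "'a set"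
  assumes fin: "finite Ones" "finite Zeros" and disj: "Ones \<inter> Zeros = {}"
  shows "(\<Sum>J | J \<subseteq> Ones \<union> Zeros \<and> card J = k. F (card (J \<inter> Ones))) =
    (\<Sum>i\<le>k. real (card Ones choose i) * real (card Zeros choose (k - i)) * F i)"
proof -
  define S where "S = (SIGMA i:{..k}. {P. P \<subseteq> Ones \<and> card P = i} \<times> {Q. Q \<subseteq> Zeros \<and> card Q = k - i})"
  have "(\<Sum>J | J \<subseteq> Ones \<union> Zeros \<and> card J = k. F (card (J \<inter> Ones))) = (\<Sum>(i, P, Q)\<in>S. F i)"
  proof (rule sum.reindex_bij_witness[of _ "\<lambda>(i, P, Q). P \<union> Q" "\<lambda>J. (card (J \<inter> Ones), J \<inter> Ones, J \<inter> Zeros)"])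
    fix J assume J: "J \<in> {J. J \<subseteq> Ones \<union> Zeros \<and> card J = k}"
    have "card (J \<inter> Ones \<union> J \<inter> Zeros) = card (J \<inter> Ones) + card (J \<inter> Zeros)"
      using fin disj by (intro card_Un_disjoint) auto
    also have "J \<inter> Ones \<union> J \<inter> Zeros = J" using J by auto
    finally show "(card (J \<inter> Ones), J \<inter> Ones, J \<inter> Zeros) \<in> S" using J by (auto simp: S_def)
    show "(case (card (J \<inter> Ones), J \<inter> Ones, J \<inter> Zeros) of (i, P, Q) \<Rightarrow> P \<union> Q) = J" using J by auto
    show "(case (card (J \<inter> Ones), J \<inter> Ones, J \<inter> Zeros) of (i, P, Q) \<Rightarrow> F i) = F (card (J \<inter> Ones))" by simp
  next
    fix t assume "t \<in> S"
    then obtain i P Q where t: "t = (i, P, Q)" "i \<le> k" "P \<subseteq> Ones" "card P = i" "Q \<subseteq> Zeros" "card Q = k - i"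
      by (auto simp: S_def)
    have "(P \<union> Q) \<inter> Ones = P" "(P \<union> Q) \<inter> Zeros = Q" "P \<inter> Q = {}" using t disj by auto
    moreover from this have "card (P \<union> Q) = k"
      using t card_Un_disjoint[OF finite_subset[OF t(3) fin(1)] finite_subset[OF t(5) fin(2)]] by simp
    ultimately show "(case t of (i, P, Q) \<Rightarrow> P \<union> Q) \<in> {J. J \<subseteq> Ones \<union> Zeros \<and> card J = k}"
        "(card ((case t of (i, P, Q) \<Rightarrow> P \<union> Q) \<inter> Ones), (case t of (i, P, Q) \<Rightarrow> P \<union> Q) \<inter> Ones,
          (case t of (i, P, Q) \<Rightarrow> P \<union> Q) \<inter> Zeros) = t"
      unfolding t(1) prod.case using t(3-6) by (simp_all add: le_supI1 le_supI2)
  qed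
  also have "\<dots> = (\<Sum>i\<le>k. \<Sum>(P, Q)\<in>{P. P \<subseteq> Ones \<and> card P = i} \<times> {Q. Q \<subseteq> Zeros \<and> card Q = k - i}. F i)"
  proof -
    have "finite {P. P \<subseteq> A \<and> card P = i}" if "finite A" for A :: "'a set" and i
      using that by (rule rev_finite_subset[OF finite_Pow_iff[THEN iffD2]]) blast
    then have "\<forall>i\<in>{..k}. finite ({P. P \<subseteq> Ones \<and> card P = i} \<times> {Q. Q \<subseteq> Zeros \<and> card Q = k - i})"
      using fin by blast
    from sum.Sigma[OF finite_atMost this, of "\<lambda>i (P, Q). F i"] show ?thesis
      by (simp add: S_def case_prod_unfold)
  qed
  also have "\<dots> = (\<Sum>i\<le>k. real (card Ones choose i) * real (card Zeros choose (k - i)) * F i)"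
    by (simp add: case_prod_unfold card_cartesian_product n_subsets[OF fin(1)] n_subsets[OF fin(2)])
  finally show ?thesis .
qed

lemma sum_binary_eq_card:
  fixes x :: "nat \<Rightarrow> nat"
  assumes "finite J" "\<And>j. j \<in> J \<Longrightarrow> x j \<in> {0, 1}"
  shows "(\<Sum>j\<in>J. x j) = card {j \<in> J. x j = 1}"
proof -
  have "card {j \<in> J. x j = 1} = (\<Sum>j | j \<in> J \<and> x j = 1. 1)" by (rule card_eq_sum)
  also have "\<dots> = (\<Sum>j\<in>J. if x j = 1 then 1 else 0)" by (rule sum.inter_filter[OF assms(1)])
  also have "\<dots> = (\<Sum>j\<in>J. x j)"
  proof (rule sum.cong[OF refl])
    fix j assume "j \<in> J"
    from assms(2)[OF this] show "(if x j = 1 then 1 else 0) = x j" by auto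
  qed
  finally show ?thesis ..
qed

lemma subset_sum_eq_u_sum:
  fixes x :: "nat \<Rightarrow> nat"
  assumes bin: "\<And>j. j \<in> {1..n} \<Longrightarrow> x j \<in> {0, 1}" and sym: "symmetric_kernel k \<phi>"
  shows "(\<Sum>J | J \<subseteq> {1..n} \<and> card J = k. \<phi> (map x (sorted_list_of_set J))) =
    u_sum n k (\<lambda>i. \<phi> (binary_word k i)) (\<Sum>j=1..n. x j)"
proof -
  define Ones where "Ones = {j \<in> {1..n}. x j = 1}"
  define Zeros where "Zeros = {j \<in> {1..n}. x j \<noteq> 1}"
  have oz: "finite Ones" "finite Zeros" "Ones \<inter> Zeros = {}" "Ones \<union> Zeros = {1..n}" by (auto simp: Ones_def Zeros_def)
  have cards: "card Ones = (\<Sum>j=1..n. x j)" "card Zeros = n - (\<Sum>j=1..n. x j)"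
  proof -
    show 1: "card Ones = (\<Sum>j=1..n. x j)"
      unfolding Ones_def by (rule sum_binary_eq_card[OF finite_atLeastAtMost bin, symmetric])
    have "card Ones + card Zeros = n" using card_Un_disjoint[OF oz(1-3)] oz(4) by simp
    then show "card Zeros = n - (\<Sum>j=1..n. x j)" using 1 by simp
  qed
  have "(\<Sum>J | J \<subseteq> {1..n} \<and> card J = k. \<phi> (map x (sorted_list_of_set J))) =
    (\<Sum>J | J \<subseteq> Ones \<union> Zeros \<and> card J = k. \<phi> (binary_word k (card (J \<inter> Ones))))"
    unfolding oz(4)
  proof (rule sum.cong[OF refl])
    fix J assume J: "J \<in> {J. J \<subseteq> {1..n} \<and> card J = k}"
    then have fin: "finite J" using finite_subset[of J "{1..n}"] by simp
    have "x ` J \<subseteq> {0, 1}" using J by (intro image_subsetI bin) auto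
    then have "map x (sorted_list_of_set J) \<in> binary_lists k"
      using J fin by (simp add: binary_lists_def)
    moreover have "sum_list (map x (sorted_list_of_set J)) = card (J \<inter> Ones)"
    proof -
      have "sum_list (map x (sorted_list_of_set J)) = (\<Sum>j\<in>J. x j)"
        using fin by (simp add: sum_list_distinct_conv_sum_set)
      also have "\<dots> = card {j \<in> J. x j = 1}" by (rule sum_binary_eq_card[OF fin], rule bin) (use J in auto)
      also have "{j \<in> J. x j = 1} = J \<inter> Ones" using J by (auto simp: Ones_def)
      finally show ?thesis .
    qed
    ultimately show "\<phi> (map x (sorted_list_of_set J)) = \<phi> (binary_word k (card (J \<inter> Ones)))"
      using symmetric_kernel_eq[OF sym] by metis
  qed
  also have "\<dots> = (\<Sum>i\<le>k. real (card Ones choose i) * real (card Zeros choose (k - i)) * \<phi> (binary_word k i))"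
    using sum_subsets_split[OF oz(1-3), of "\<lambda>i. \<phi> (binary_word k i)" k] by simp
  finally show ?thesis by (simp add: u_sum_def cards)
qed

section \<open>Binary processes with a de Finetti measure\<close>

lemma sum_list_subvec: "sum_list (subvec X {1..n} \<omega>) = (\<Sum>j=1..n. X j \<omega>)"
  by (simp add: subvec_def sum_list_distinct_conv_sum_set)

lemma sorted_list_of_set_Icc: "sorted_list_of_set {m..n} = [m..<Suc n]"
  unfolding atLeastLessThanSuc_atLeastAtMost[symmetric] by (rule sorted_list_of_set_range)

lemma subvec_Suc: "subvec X {1..Suc n} \<omega> = subvec X {1..n} \<omega> @ [X (Suc n) \<omega>]"
  by (simp add: subvec_def sorted_list_of_set_Icc)

lemma subvec_Cons:
  assumes "1 \<le> k" shows "subvec X {1..k} \<omega> = X 1 \<omega> # subvec X {2..k} \<omega>"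
proof -
  have "1 < Suc k" using assms by simp
  from upt_conv_Cons[OF this] show ?thesis
    unfolding subvec_def sorted_list_of_set_Icc by (simp only: Suc_1 list.map)
qed

lemma length_subvec [simp]: "finite J \<Longrightarrow> length (subvec X J \<omega>) = card J"
  by (simp add: subvec_def)

locale binary_process = prob_space M for M :: "'a measure" +
  fixes X :: "nat \<Rightarrow> 'a \<Rightarrow> nat" and \<gamma> :: "real measure"
  assumes X_measurable: "\<And>n. n \<ge> 1 \<Longrightarrow> X n \<in> M \<rightarrow>\<^sub>M count_space {0, 1}"
    and de_finetti: "is_de_finetti_measure M X \<gamma>"
begin

lemma X_01: "n \<ge> 1 \<Longrightarrow> \<omega> \<in> space M \<Longrightarrow> X n \<omega> \<in> {0, 1}"
  using X_measurable[THEN measurable_space] by simp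

lemma X_measurable_UNIV: "n \<ge> 1 \<Longrightarrow> X n \<in> M \<rightarrow>\<^sub>M count_space UNIV"
  by (rule measurable_compose[OF X_measurable]) auto

lemma subvec_binary:
  assumes "finite J" "0 \<notin> J" "\<omega> \<in> space M"
  shows "subvec X J \<omega> \<in> binary_lists (card J)"
proof -
  have "X j \<omega> \<in> {0, 1}" if "j \<in> J" for j
  proof -
    have "j \<noteq> 0" using that assms(2) by metis
    then show ?thesis using assms(3) by (intro X_01) auto
  qed
  then have "(\<lambda>j. X j \<omega>) ` J \<subseteq> {0, 1}" by (intro image_subsetI)
  then show ?thesis using assms(1) by (simp add: binary_lists_def subvec_def)
qed

text \<open>By \<open>prob_pattern\<close> this is the probability of any fixed word with
  \<open>i\<close> ones and \<open>j\<close> zeros; it will instantiate \<open>a\<close>.\<close>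

definition moment :: "nat \<Rightarrow> nat \<Rightarrow> real" where
  "moment i j = (\<integral>\<theta>. \<theta> ^ i * (1 - \<theta>) ^ j \<partial>\<gamma>)"

lemma prob_\<gamma>: "prob_space \<gamma>" and sets_\<gamma>: "sets \<gamma> = sets (restrict_space borel {0..1})"
  using de_finetti by (auto simp: is_de_finetti_measure_def)

lemma space_\<gamma>: "space \<gamma> = {0..1}"
  using sets_eq_imp_space_eq[OF sets_\<gamma>] by (simp add: space_restrict_space)

lemma integrable_\<gamma>:
  fixes f :: "real \<Rightarrow> real"
  assumes "f \<in> borel_measurable borel" "\<And>\<theta>. 0 \<le> \<theta> \<Longrightarrow> \<theta> \<le> 1 \<Longrightarrow> \<bar>f \<theta>\<bar> \<le> B"
  shows "integrable \<gamma> f"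
proof -
  interpret \<gamma>: prob_space \<gamma> by (rule prob_\<gamma>)
  show ?thesis
    by (rule \<gamma>.integrable_const_bound[of _ B])
      (use assms in \<open>auto intro!: borel_measurable_unit_interval[OF sets_\<gamma>] simp: space_\<gamma>\<close>)
qed

lemma integrable_moment: "integrable \<gamma> (\<lambda>\<theta>. \<theta> ^ i * (1 - \<theta>) ^ j)"
  by (rule integrable_\<gamma>[of _ 1]) (auto simp: abs_mult power_abs intro!: mult_le_one power_le_one)

lemma moment_merge: "moment (Suc i) j + moment i (Suc j) = moment i j"
proof -
  have "moment (Suc i) j + moment i (Suc j) =
      (\<integral>\<theta>. \<theta> ^ Suc i * (1 - \<theta>) ^ j + \<theta> ^ i * (1 - \<theta>) ^ Suc j \<partial>\<gamma>)"
    unfolding moment_def by (rule Bochner_Integration.integral_add[symmetric]; rule integrable_moment)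
  also have "\<dots> = moment i j"
    unfolding moment_def by (rule Bochner_Integration.integral_cong) (auto simp: algebra_simps)
  finally show ?thesis .
qed

lemma moment_00: "moment 0 0 = 1"
proof -
  interpret \<gamma>: prob_space \<gamma> by (rule prob_\<gamma>)
  show ?thesis by (simp add: moment_def \<gamma>.prob_space)
qed

text \<open>The index \<open>0\<close> is excluded because measurability of \<open>X 0\<close> is
  not assumed.\<close>

lemma event_sets:
  assumes "finite J" "0 \<notin> J" shows "{\<omega> \<in> space M. subvec X J \<omega> = xs} \<in> sets M"
proof -
  have "X j \<in> M \<rightarrow>\<^sub>M count_space UNIV" if "j \<in> J" for j
  proof -
    have "j \<noteq> 0" using that assms(2) by metis
    then show ?thesis by (intro X_measurable_UNIV) auto
  qed
  then have "(\<lambda>\<omega>. map (\<lambda>j. X j \<omega>) L) \<in> M \<rightarrow>\<^sub>M count_space UNIV" if "set L \<subseteq> J" for L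
    using that
  proof (induction L)
    case (Cons j L)
    have [measurable]: "(\<lambda>\<omega>. map (\<lambda>j. X j \<omega>) L) \<in> M \<rightarrow>\<^sub>M count_space UNIV" "X j \<in> M \<rightarrow>\<^sub>M count_space UNIV"
      using Cons by auto
    show ?case by simp measurable
  qed simp
  then have [measurable]: "subvec X J \<in> M \<rightarrow>\<^sub>M count_space UNIV"
    using assms(1) by (simp add: subvec_def[abs_def])
  show ?thesis by measurable
qed

lemma prob_pattern:
  assumes xs: "xs \<in> binary_lists n"
  shows "prob {\<omega> \<in> space M. subvec X {1..n} \<omega> = xs} = moment (sum_list xs) (n - sum_list xs)"
\<comment> \<open>The de Finetti formula is stated for \<open>n \<ge> 1\<close>; the empty word has
  probability \<open>1\<close>.\<close>
proof (cases "n = 0")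
  case True
  then show ?thesis using xs moment_00 by (simp add: binary_lists_0 subvec_def prob_space)
next
  case False
  have len: "length xs = n" using xs by (simp add: binary_lists_def)
  have sub: "subvec X {1..n} \<omega> = xs \<longleftrightarrow> (\<forall>k\<in>{1..n}. X k \<omega> = xs ! (k - 1))" for \<omega>
  proof
    assume "subvec X {1..n} \<omega> = xs"
    then have eq: "xs = map (\<lambda>j. X j \<omega>) [1..<Suc n]" by (simp only: subvec_def sorted_list_of_set_Icc)
    show "\<forall>k\<in>{1..n}. X k \<omega> = xs ! (k - 1)"
    proof
      fix k assume "k \<in> {1..n}"
      then show "X k \<omega> = xs ! (k - 1)" unfolding eq by (subst nth_map) (auto simp del: upt_Suc)
    qed
  next
    assume R: "\<forall>k\<in>{1..n}. X k \<omega> = xs ! (k - 1)"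
    show "subvec X {1..n} \<omega> = xs"
    proof (rule nth_equalityI)
      fix i assume "i < length (subvec X {1..n} \<omega>)"
      then have i: "i < n" by simp
      then show "subvec X {1..n} \<omega> ! i = xs ! i"
        using R[rule_format, of "Suc i"] by (simp add: subvec_def sorted_list_of_set_Icc del: upt_Suc)
    qed (simp add: len)
  qed
  have sum: "(\<Sum>k=1..n. xs ! (k - 1)) = sum_list xs"
    unfolding sum_list_sum_nth len
    by (rule sum.reindex_bij_witness[of _ Suc "\<lambda>k. k - 1"]) auto
  have bin: "\<forall>k\<in>{1..n}. xs ! (k - 1) \<in> {0, 1}"
  proof
    fix k assume "k \<in> {1..n}"
    then have "xs ! (k - 1) \<in> set xs" using len by auto
    then show "xs ! (k - 1) \<in> {0, 1}" using xs by (auto simp: binary_lists_def)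
  qed
  have formula: "\<forall>n\<ge>1. \<forall>j. (\<forall>k\<in>{1..n}. j k \<in> {0, 1}) \<longrightarrow>
        \<P>(\<omega> in M. \<forall>k\<in>{1..n}. X k \<omega> = j k) =
        (\<integral>\<theta>. \<theta> ^ (\<Sum>k=1..n. j k) * (1 - \<theta>) ^ (n - (\<Sum>k=1..n. j k)) \<partial>\<gamma>)"
    using de_finetti unfolding is_de_finetti_measure_def by blast
  have "n \<ge> 1" using False by simp
  from formula[THEN spec, THEN mp, OF this, THEN spec, THEN mp, OF bin]
  have "\<P>(\<omega> in M. \<forall>k\<in>{1..n}. X k \<omega> = xs ! (k - 1)) =
      (\<integral>\<theta>. \<theta> ^ (\<Sum>k=1..n. xs ! (k - 1)) * (1 - \<theta>) ^ (n - (\<Sum>k=1..n. xs ! (k - 1))) \<partial>\<gamma>)" .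
  then show ?thesis unfolding sum sub moment_def .
qed

lemma expectation_subvec:
  fixes \<Phi> :: "nat list \<Rightarrow> real"
  shows "(\<integral>\<omega>. \<Phi> (subvec X {1..n} \<omega>) \<partial>M) =
    (\<Sum>xs\<in>binary_lists n. \<Phi> xs * moment (sum_list xs) (n - sum_list xs))"
proof -
  let ?E = "\<lambda>xs. {\<omega> \<in> space M. subvec X {1..n} \<omega> = xs}"
  have sets: "?E xs \<in> sets M" for xs by (rule event_sets) auto
  have "(\<integral>\<omega>. \<Phi> (subvec X {1..n} \<omega>) \<partial>M) = (\<integral>\<omega>. (\<Sum>xs\<in>binary_lists n. \<Phi> xs * indicator (?E xs) \<omega>) \<partial>M)"
  proof (rule Bochner_Integration.integral_cong[OF refl])
    fix \<omega> assume \<omega>: "\<omega> \<in> space M"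
    have "subvec X {1..n} \<omega> \<in> binary_lists n" using subvec_binary[of "{1..n}" \<omega>] \<omega> by simp
    then show "\<Phi> (subvec X {1..n} \<omega>) = (\<Sum>xs\<in>binary_lists n. \<Phi> xs * indicator (?E xs) \<omega>)"
      using \<omega> by (simp add: indicator_def of_bool_def if_distrib[of "times _"] cong: if_cong)
  qed
  also have "\<dots> = (\<Sum>xs\<in>binary_lists n. \<integral>\<omega>. \<Phi> xs * indicator (?E xs) \<omega> \<partial>M)"
    using sets by (intro Bochner_Integration.integral_sum integrable_mult_right integrable_real_indicator) (auto simp: emeasure_eq_measure)
  also have "\<dots> = (\<Sum>xs\<in>binary_lists n. \<Phi> xs * moment (sum_list xs) (n - sum_list xs))"
    using sets by (intro sum.cong refl) (simp add: prob_pattern[unfolded One_nat_def])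
  finally show ?thesis .
qed

lemma expectation_sum:
  fixes F :: "nat \<Rightarrow> real"
  shows "(\<integral>\<omega>. F (sum_list (subvec X {1..n} \<omega>)) \<partial>M) = (\<Sum>s\<le>n. real (n choose s) * moment s (n - s) * F s)"
  using expectation_subvec[of "\<lambda>xs. F (sum_list xs)" n]
    sum_binary_lists[of "\<lambda>s. F s * moment s (n - s)" n] by (simp add: mult_ac)

lemma prob_first: "\<P>(\<omega> in M. X 1 \<omega> = 1) = moment 1 0"
proof -
  have "{\<omega> \<in> space M. X 1 \<omega> = 1} = {\<omega> \<in> space M. subvec X {1..1} \<omega> = [1]}"
    by (simp add: subvec_def)
  moreover have "[1] \<in> binary_lists 1" by (simp add: binary_lists_def)
  ultimately show ?thesis using prob_pattern[of "[1]" 1] by simp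
qed

lemma prob_first_two: "\<P>(\<omega> in M. X 1 \<omega> = 1 \<and> X 2 \<omega> = 1) = moment 2 0"
proof -
  have "subvec X {1..2} \<omega> = [X 1 \<omega>, X 2 \<omega>]" for \<omega>
    unfolding subvec_def sorted_list_of_set_Icc by (simp add: upt_rec numeral_2_eq_2)
  then have "{\<omega> \<in> space M. X 1 \<omega> = 1 \<and> X 2 \<omega> = 1} = {\<omega> \<in> space M. subvec X {1..2} \<omega> = [1, 1]}" by auto
  moreover have "[1, 1] \<in> binary_lists 2" by (simp add: binary_lists_def)
  ultimately show ?thesis using prob_pattern[of "[1, 1]" 2] by (simp add: numeral_2_eq_2)
qed

end

section \<open>Mixing measures that charge the open unit interval\<close>

locale mixed_binary_process = binary_process +
  assumes mixed: "0 < moment 1 1"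
begin

text \<open>A vanishing moment would put \<open>\<theta>\<close> in \<open>{0, 1}\<close> almost
  everywhere, and then \<open>moment 1 1\<close> would vanish too.\<close>

lemma moment_pos: "moment i j > 0"
proof -
  have nonneg: "AE \<theta> in \<gamma>. 0 \<le> \<theta> ^ i * (1 - \<theta>) ^ j" for i j
    by (rule AE_I2) (simp add: space_\<gamma>)
  have "moment i j \<noteq> 0"
  proof
    assume "moment i j = 0"
    then have "AE \<theta> in \<gamma>. \<theta> ^ i * (1 - \<theta>) ^ j = 0"
      using integral_nonneg_eq_0_iff_AE[OF integrable_moment nonneg] by (simp add: moment_def)
    then have "AE \<theta> in \<gamma>. \<theta> ^ 1 * (1 - \<theta>) ^ 1 = 0" by eventually_elim auto
    then have "moment 1 1 = 0"
      unfolding moment_def using integral_nonneg_eq_0_iff_AE[OF integrable_moment nonneg, of 1 1] by blast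
    then show False using mixed by simp
  qed
  moreover have "moment i j \<ge> 0" unfolding moment_def by (rule integral_nonneg_AE[OF nonneg])
  ultimately show ?thesis by simp
qed

sublocale pattern_probabilities moment
  by unfold_locales (rule moment_pos moment_merge moment_00)+

text \<open>Nonnegativity of a variance: under the normalised weight
  \<open>\<theta> ^ i * (1 - \<theta>) ^ j\<close> the mean of \<open>\<theta>\<close> is
  \<open>t = up i j\<close>, and its second moment is at least \<open>t\<^sup>2\<close>.\<close>

lemma up_mono: "up i j \<le> up (Suc i) j"
proof -
  define t where "t = moment (Suc i) j / moment i j"
  have "0 \<le> (\<integral>\<theta>. (\<theta> - t)\<^sup>2 * (\<theta> ^ i * (1 - \<theta>) ^ j) \<partial>\<gamma>)"
    by (rule integral_nonneg_AE, rule AE_I2) (simp add: space_\<gamma>)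
  also have "\<dots> = (\<integral>\<theta>. \<theta> ^ Suc (Suc i) * (1 - \<theta>) ^ j - 2 * t * (\<theta> ^ Suc i * (1 - \<theta>) ^ j) + t\<^sup>2 * (\<theta> ^ i * (1 - \<theta>) ^ j) \<partial>\<gamma>)"
    by (rule Bochner_Integration.integral_cong) (auto simp: power2_eq_square algebra_simps)
  also have "\<dots> = moment (Suc (Suc i)) j - 2 * t * moment (Suc i) j + t\<^sup>2 * moment i j"
    unfolding moment_def
    by (simp add: integrable_moment Bochner_Integration.integral_add Bochner_Integration.integral_diff del: power_Suc)
  finally have "0 \<le> moment (Suc (Suc i)) j - 2 * t * moment (Suc i) j + t\<^sup>2 * moment i j" .
  then have "t * moment (Suc i) j \<le> moment (Suc (Suc i)) j"
    using moment_pos[of i j] by (simp add: t_def power2_eq_square)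
  then show ?thesis
    using moment_pos[of "Suc i" j] by (simp add: up_def t_def pos_le_divide_eq)
qed

end

context binary_process begin

section \<open>Conditioning on finitely many coordinates\<close>

lemma space_generated_by [simp]: "space (generated_by M X I) = space M"
  unfolding generated_by_def by (rule space_measure_of) auto

lemma sets_generated_by:
  "sets (generated_by M X I) = sigma_sets (space M) {X i -` A \<inter> space M | i A. i \<in> I}"
  unfolding generated_by_def by (rule sets_measure_of) auto

lemma subalgebra_generated_by:
  assumes "0 \<notin> I" shows "subalgebra M (generated_by M X I)"
proof -
  have "X i -` A \<inter> space M \<in> sets M" if "i \<in> I" for i A
  proof -
    have "i \<noteq> 0" using that assms by metis
    then show ?thesis by (intro measurable_sets[OF X_measurable_UNIV]) auto
  qed
  then have "sigma_sets (space M) {X i -` A \<inter> space M | i A. i \<in> I} \<subseteq> sets M"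
    by (intro sets.sigma_sets_subset) auto
  then show ?thesis by (simp add: subalgebra_def sets_generated_by)
qed

text \<open>Events decided by the finite vector \<open>subvec X I\<close> contain the generators and
  are closed under complements and countable unions.\<close>

lemma generated_by_form:
  assumes "finite I" "A \<in> sets (generated_by M X I)"
  obtains Q where "A = {\<omega> \<in> space M. subvec X I \<omega> \<in> Q}"
proof -
  have "A \<in> sigma_sets (space M) {X i -` A \<inter> space M | i A. i \<in> I}"
    using assms(2) by (simp add: sets_generated_by)
  then have "\<exists>Q. A = {\<omega> \<in> space M. subvec X I \<omega> \<in> Q}"
  proof induction
    case (Basic a)
    then obtain i B where i: "i \<in> I" "a = X i -` B \<inter> space M" by blast
    then obtain n where n: "n < length (sorted_list_of_set I)" "sorted_list_of_set I ! n = i"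
      using assms(1) by (metis in_set_conv_nth set_sorted_list_of_set)
    have "a = {\<omega> \<in> space M. subvec X I \<omega> \<in> {xs. xs ! n \<in> B}}"
      using i(2) n by (auto simp: subvec_def)
    then show ?case by blast
  next
    case Empty
    have "{} = {\<omega> \<in> space M. subvec X I \<omega> \<in> {}}" by simp
    then show ?case by blast
  next
    case (Compl a)
    then obtain Q where "a = {\<omega> \<in> space M. subvec X I \<omega> \<in> Q}" by blast
    then have "space M - a = {\<omega> \<in> space M. subvec X I \<omega> \<in> - Q}" by auto
    then show ?case by blast
  next
    case (Union a)
    then obtain Q where "\<And>i. a i = {\<omega> \<in> space M. subvec X I \<omega> \<in> Q i}" by metis
    then have "\<Union> (range a) = {\<omega> \<in> space M. subvec X I \<omega> \<in> (\<Union>i. Q i)}" by auto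
    then show ?case by blast
  qed
  then show ?thesis using that by blast
qed

lemma event_generated_by:
  assumes "finite I"
  shows "{\<omega> \<in> space M. subvec X I \<omega> = ys} \<in> sets (generated_by M X I)" (is "?E \<in> sets ?G")
proof (cases "length ys = card I")
  case False
  then have "subvec X I \<omega> \<noteq> ys" for \<omega> using length_subvec[OF assms, of X \<omega>] by auto
  then have "?E = {}" by simp
  show ?thesis unfolding \<open>?E = {}\<close> by simp
next
  case True
  let ?L = "sorted_list_of_set I"
  have "subvec X I \<omega> = ys \<longleftrightarrow> (\<forall>n\<in>{..<card I}. X (?L ! n) \<omega> = ys ! n)" for \<omega>
    by (subst list_eq_iff_nth_eq) (simp add: True assms, simp add: subvec_def Ball_def)
  then have "?E = {\<omega> \<in> space ?G. \<forall>n\<in>{..<card I}. X (?L ! n) \<omega> = ys ! n}" by simp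
  also have "\<dots> \<in> sets ?G"
  proof (rule sets.sets_Collect_finite_All)
    fix n assume n: "n \<in> {..<card I}"
    then have "?L ! n \<in> I" using assms by (metis lessThan_iff length_sorted_list_of_set nth_mem set_sorted_list_of_set)
    then have "X (?L ! n) -` {ys ! n} \<inter> space M \<in> sets ?G"
      unfolding sets_generated_by by (intro sigma_sets.Basic) blast
    moreover have "X (?L ! n) -` {ys ! n} \<inter> space M = {\<omega> \<in> space ?G. X (?L ! n) \<omega> = ys ! n}" by auto
    ultimately show "{\<omega> \<in> space ?G. X (?L ! n) \<omega> = ys ! n} \<in> sets ?G" by simp
  qed auto
  finally show ?thesis .
qed

text \<open>The generated algebra has finitely many atoms, one for each word \<open>ys\<close>, so
  the almost sure identity can be tested on the atoms alone.\<close>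

lemma real_cond_exp_eq_iff:
  fixes F :: "'a \<Rightarrow> real" and g :: "nat list \<Rightarrow> real"
  assumes I: "finite I" "0 \<notin> I" and F: "integrable M F"
  shows "(AE \<omega> in M. real_cond_exp M (generated_by M X I) F \<omega> = g (subvec X I \<omega>)) \<longleftrightarrow>
    (\<forall>ys\<in>binary_lists (card I). (\<integral>\<omega>. indicator {\<omega> \<in> space M. subvec X I \<omega> = ys} \<omega> * F \<omega> \<partial>M) =
      g ys * prob {\<omega> \<in> space M. subvec X I \<omega> = ys})"
proof -
  let ?G = "generated_by M X I"
  let ?E = "\<lambda>ys. {\<omega> \<in> space M. subvec X I \<omega> = ys}"
  let ?B = "binary_lists (card I)"
  interpret finite_measure_subalgebra M ?G
    by unfold_locales (rule subalgebra_generated_by[OF I(2)])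
  have sets: "?E ys \<in> sets M" for ys by (rule event_sets[OF I])
  have sets_G: "?E ys \<in> sets ?G" for ys by (rule event_generated_by[OF I(1)])
  have B: "subvec X I \<omega> \<in> ?B" if "\<omega> \<in> space M" for \<omega> by (rule subvec_binary[OF I that])
  \<comment> \<open>A version of \<open>g (subvec X I \<omega>)\<close> written as a combination of
    atom indicators, so that measurability is immediate.\<close>
  define g' where "g' \<omega> = (\<Sum>ys\<in>?B. g ys * indicator (?E ys) \<omega>)" for \<omega>
  have expand: "(\<Sum>ys\<in>?B. c ys * indicator (?E ys) \<omega>) = c (subvec X I \<omega>)" if "\<omega> \<in> space M" for c :: "nat list \<Rightarrow> real" and \<omega>
    using B[OF that] that by (simp add: indicator_def of_bool_def if_distrib[of "times _"] cong: if_cong)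
  have g'_eq: "g' \<omega> = g (subvec X I \<omega>)" if "\<omega> \<in> space M" for \<omega>
    unfolding g'_def by (rule expand[OF that])
  have AE_eq: "(AE \<omega> in M. real_cond_exp M ?G F \<omega> = g (subvec X I \<omega>)) \<longleftrightarrow> (AE \<omega> in M. real_cond_exp M ?G F \<omega> = g' \<omega>)"
    by (intro AE_cong) (simp add: g'_eq)
  have g'_int: "integrable M g'"
    unfolding g'_def using sets
    by (intro Bochner_Integration.integrable_sum integrable_mult_right integrable_real_indicator) (auto simp: emeasure_eq_measure)
  have g'_meas: "g' \<in> borel_measurable ?G"
    unfolding g'_def using sets_G by (intro borel_measurable_sum borel_measurable_times borel_measurable_indicator borel_measurable_const)
  have g'_atom: "(\<integral>\<omega>. indicator (?E ys) \<omega> * g' \<omega> \<partial>M) = g ys * prob (?E ys)" for ys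
  proof -
    have "(\<integral>\<omega>. indicator (?E ys) \<omega> * g' \<omega> \<partial>M) = (\<integral>\<omega>. g ys * indicator (?E ys) \<omega> \<partial>M)"
      by (rule Bochner_Integration.integral_cong) (auto simp: g'_eq indicator_def)
    then show ?thesis using sets by simp
  qed
  show ?thesis
    unfolding AE_eq
  proof
    assume AE: "AE \<omega> in M. real_cond_exp M ?G F \<omega> = g' \<omega>"
    show "\<forall>ys\<in>?B. (\<integral>\<omega>. indicator (?E ys) \<omega> * F \<omega> \<partial>M) = g ys * prob (?E ys)"
    proof
      fix ys assume "ys \<in> ?B"
      have "(\<integral>\<omega>. indicator (?E ys) \<omega> * F \<omega> \<partial>M) = (\<integral>\<omega>. indicator (?E ys) \<omega> * real_cond_exp M ?G F \<omega> \<partial>M)"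
        using real_cond_exp_intA[OF F sets_G] by (simp add: set_lebesgue_integral_def)
      also have "\<dots> = (\<integral>\<omega>. indicator (?E ys) \<omega> * g' \<omega> \<partial>M)"
      proof (rule integral_cong_AE)
        show "AE \<omega> in M. indicator (?E ys) \<omega> * real_cond_exp M ?G F \<omega> = indicator (?E ys) \<omega> * g' \<omega>"
          using AE by eventually_elim simp
        show "(\<lambda>\<omega>. indicator (?E ys) \<omega> * real_cond_exp M ?G F \<omega>) \<in> borel_measurable M"
          using sets by (intro borel_measurable_times borel_measurable_indicator borel_measurable_cond_exp2)
        show "(\<lambda>\<omega>. indicator (?E ys) \<omega> * g' \<omega>) \<in> borel_measurable M"
          using sets g'_int by (intro borel_measurable_times borel_measurable_indicator borel_measurable_integrable)
      qed
      finally show "(\<integral>\<omega>. indicator (?E ys) \<omega> * F \<omega> \<partial>M) = g ys * prob (?E ys)" using g'_atom by simp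
    qed
  next
    assume atoms: "\<forall>ys\<in>?B. (\<integral>\<omega>. indicator (?E ys) \<omega> * F \<omega> \<partial>M) = g ys * prob (?E ys)"
    show "AE \<omega> in M. real_cond_exp M ?G F \<omega> = g' \<omega>"
    proof (rule real_cond_exp_charact[OF _ F g'_int g'_meas])
      fix A assume "A \<in> sets ?G"
      then obtain Q where A: "A = {\<omega> \<in> space M. subvec X I \<omega> \<in> Q}" using generated_by_form[OF I(1)] by metis
      have split: "(\<integral>\<omega>\<in>A. h \<omega> \<partial>M) = (\<Sum>ys\<in>?B. of_bool (ys \<in> Q) * (\<integral>\<omega>. indicator (?E ys) \<omega> * h \<omega> \<partial>M))"
        if "integrable M h" for h :: "'a \<Rightarrow> real"
      proof -
        have "(\<integral>\<omega>\<in>A. h \<omega> \<partial>M) = (\<integral>\<omega>. (\<Sum>ys\<in>?B. of_bool (ys \<in> Q) * (indicator (?E ys) \<omega> * h \<omega>)) \<partial>M)"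
          unfolding set_lebesgue_integral_def
        proof (rule Bochner_Integration.integral_cong[OF refl])
          fix \<omega> assume \<omega>: "\<omega> \<in> space M"
          have "(\<Sum>ys\<in>?B. of_bool (ys \<in> Q) * (indicator (?E ys) \<omega> * h \<omega>)) =
            (\<Sum>ys\<in>?B. of_bool (ys \<in> Q) * indicator (?E ys) \<omega>) * h \<omega>"
            by (simp add: sum_distrib_right mult.assoc)
          also have "\<dots> = of_bool (subvec X I \<omega> \<in> Q) * h \<omega>" unfolding expand[OF \<omega>] ..
          finally have eq: "(\<Sum>ys\<in>?B. of_bool (ys \<in> Q) * (indicator (?E ys) \<omega> * h \<omega>)) =
            of_bool (subvec X I \<omega> \<in> Q) * h \<omega>" .
          show "indicator A \<omega> *\<^sub>R h \<omega> = (\<Sum>ys\<in>?B. of_bool (ys \<in> Q) * (indicator (?E ys) \<omega> * h \<omega>))"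
            unfolding eq using \<omega> by (simp add: A indicator_def)
        qed
        also have "\<dots> = (\<Sum>ys\<in>?B. \<integral>\<omega>. of_bool (ys \<in> Q) * (indicator (?E ys) \<omega> * h \<omega>) \<partial>M)"
          using integrable_mult_indicator[OF sets that]
          by (intro Bochner_Integration.integral_sum integrable_mult_right) simp
        finally show ?thesis by simp
      qed
      show "(\<integral>\<omega>\<in>A. F \<omega> \<partial>M) = (\<integral>\<omega>\<in>A. g' \<omega> \<partial>M)"
        unfolding split[OF F] split[OF g'_int] g'_atom using atoms by (intro sum.cong refl) simp
    qed
  qed
qed

lemma integrable_subvec:
  fixes \<Phi> :: "nat list \<Rightarrow> real"
  assumes I: "finite I" "0 \<notin> I"
  shows "integrable M (\<lambda>\<omega>. \<Phi> (subvec X I \<omega>))"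
proof -
  let ?E = "\<lambda>ys. {\<omega> \<in> space M. subvec X I \<omega> = ys}"
  have "integrable M (\<lambda>\<omega>. \<Sum>ys\<in>binary_lists (card I). \<Phi> ys * indicator (?E ys) \<omega>)"
    using event_sets[OF I]
    by (intro Bochner_Integration.integrable_sum integrable_mult_right integrable_real_indicator) (auto simp: emeasure_eq_measure)
  moreover have "(\<Sum>ys\<in>binary_lists (card I). \<Phi> ys * indicator (?E ys) \<omega>) = \<Phi> (subvec X I \<omega>)"
    if "\<omega> \<in> space M" for \<omega>
    using subvec_binary[OF I that] that by (simp add: indicator_def of_bool_def if_distrib[of "times _"] cong: if_cong)
  ultimately show ?thesis by (subst Bochner_Integration.integrable_cong[OF refl]) auto
qed

end

context mixed_binary_process begin

text \<open>On the atom given by the word \<open>ys\<close> of the last \<open>k - 1\<close>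
  entries, the first entry is \<open>0\<close> or \<open>1\<close>; these two words give the two
  terms of \<open>degenerate_kernel\<close>.\<close>

lemma degenerate_iff_cond_exp:
  assumes k: "k \<ge> 1" and sym: "symmetric_kernel k \<phi>"
  shows "(AE \<omega> in M. real_cond_exp M (generated_by M X {2..k}) (\<lambda>\<omega>. \<phi> (subvec X {1..k} \<omega>)) \<omega> = 0) \<longleftrightarrow>
    degenerate_kernel k (\<lambda>i. \<phi> (binary_word k i))"
proof -
  define \<phi>c where "\<phi>c i = \<phi> (binary_word k i)" for i
  obtain m where m: "k = Suc m" using k by (cases k) auto
  \<comment> \<open>For \<open>k = 1\<close> the index set is empty, its only word is
    \<open>[]\<close>, and the condition concerns the plain expectation.\<close>
  have card: "card {2..k} = m" by (simp add: m)
  have atom: "(\<integral>\<omega>. indicator {\<omega> \<in> space M. subvec X {2..k} \<omega> = ys} \<omega> * \<phi> (subvec X {1..k} \<omega>) \<partial>M) =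
     moment (Suc (sum_list ys)) (k - 1 - sum_list ys) * \<phi>c (Suc (sum_list ys)) +
     moment (sum_list ys) (k - sum_list ys) * \<phi>c (sum_list ys)" if ys: "ys \<in> binary_lists m" for ys
  proof -
    have "(\<integral>\<omega>. indicator {\<omega> \<in> space M. subvec X {2..k} \<omega> = ys} \<omega> * \<phi> (subvec X {1..k} \<omega>) \<partial>M) =
      (\<integral>\<omega>. (\<lambda>xs. of_bool (tl xs = ys) * \<phi> xs) (subvec X {1..k} \<omega>) \<partial>M)"
      by (rule Bochner_Integration.integral_cong[OF refl]) (simp add: subvec_Cons[OF k, unfolded One_nat_def] indicator_def)
    also have "\<dots> = (\<Sum>xs\<in>binary_lists k. of_bool (tl xs = ys) * \<phi> xs * moment (sum_list xs) (k - sum_list xs))"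
      by (rule expectation_subvec)
    also have "\<dots> = (\<Sum>zs\<in>binary_lists m. of_bool (zs = ys) * (\<phi> (0 # zs) * moment (sum_list zs) (k - sum_list zs))) +
       (\<Sum>zs\<in>binary_lists m. of_bool (zs = ys) * (\<phi> (1 # zs) * moment (Suc (sum_list zs)) (k - Suc (sum_list zs))))"
      by (simp add: m sum_binary_lists_Suc mult.assoc)
    also have "\<dots> = \<phi> (0 # ys) * moment (sum_list ys) (k - sum_list ys) +
       \<phi> (1 # ys) * moment (Suc (sum_list ys)) (k - Suc (sum_list ys))"
      using ys by (simp add: of_bool_def if_distrib[of "\<lambda>x. x * _"] cong: if_cong)
    also have "\<phi> (0 # ys) = \<phi>c (sum_list ys)"
      using symmetric_kernel_eq[OF sym, of "0 # ys"] ys by (simp add: \<phi>c_def m binary_lists_Suc)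
    also have "\<phi> (1 # ys) = \<phi>c (Suc (sum_list ys))"
      using symmetric_kernel_eq[OF sym, of "1 # ys"] ys by (simp add: \<phi>c_def m binary_lists_Suc)
    finally show ?thesis by (simp add: mult.commute add.commute)
  qed
  have "(AE \<omega> in M. real_cond_exp M (generated_by M X {2..k}) (\<lambda>\<omega>. \<phi> (subvec X {1..k} \<omega>)) \<omega> = 0) \<longleftrightarrow>
    (\<forall>ys\<in>binary_lists m. (\<integral>\<omega>. indicator {\<omega> \<in> space M. subvec X {2..k} \<omega> = ys} \<omega> * \<phi> (subvec X {1..k} \<omega>) \<partial>M) = 0)"
    using real_cond_exp_eq_iff[of "{2..k}" "\<lambda>\<omega>. \<phi> (subvec X {1..k} \<omega>)" "\<lambda>_. 0"]
      integrable_subvec[of "{1..k}" \<phi>] unfolding card by simp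
  also have "\<dots> \<longleftrightarrow> (\<forall>ys\<in>binary_lists m.
     moment (Suc (sum_list ys)) (k - 1 - sum_list ys) * \<phi>c (Suc (sum_list ys)) +
     moment (sum_list ys) (k - sum_list ys) * \<phi>c (sum_list ys) = 0)"
    by (intro ball_cong refl) (simp only: atom)
  also have "\<dots> \<longleftrightarrow> degenerate_kernel k \<phi>c"
    unfolding degenerate_kernel_def
  proof (intro iffI allI impI ballI)
    fix t assume *: "\<forall>ys\<in>binary_lists m.
     moment (Suc (sum_list ys)) (k - 1 - sum_list ys) * \<phi>c (Suc (sum_list ys)) +
     moment (sum_list ys) (k - sum_list ys) * \<phi>c (sum_list ys) = 0" and "t < k"
    then have "binary_word m t \<in> binary_lists m" by (simp add: m)
    from *[rule_format, OF this] show "moment (Suc t) (k - 1 - t) * \<phi>c (Suc t) + moment t (k - t) * \<phi>c t = 0" by simp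
  next
    fix ys assume *: "\<forall>t<k. moment (Suc t) (k - 1 - t) * \<phi>c (Suc t) + moment t (k - t) * \<phi>c t = 0"
      and "ys \<in> binary_lists m"
    then have "sum_list ys < k" using sum_list_binary_le[of ys m] by (simp add: m)
    with * show "moment (Suc (sum_list ys)) (k - 1 - sum_list ys) * \<phi>c (Suc (sum_list ys)) +
     moment (sum_list ys) (k - sum_list ys) * \<phi>c (sum_list ys) = 0" by blast
  qed
  finally show ?thesis unfolding \<phi>c_def[abs_def] .
qed

end

section \<open>Hoeffding decomposability and the urn property in terms of moments\<close>

context mixed_binary_process begin

lemma U_stat_eq_u_sum:
  assumes "symmetric_kernel k \<phi>" "\<omega> \<in> space M"
  shows "U_stat X n k \<phi> \<omega> = u_sum n k (\<lambda>i. \<phi> (binary_word k i)) (sum_list (subvec X {1..n} \<omega>))"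
  unfolding U_stat_def subvec_def[of X _ \<omega>] sum_list_subvec[unfolded subvec_def]
  by (rule subset_sum_eq_u_sum) (use assms X_01 in auto)

lemma U_stat_in_L_s:
  assumes sym: "symmetric_kernel k \<phi>"
  shows "U_stat X n k \<phi> \<in> L_s X n"
proof -
  \<comment> \<open>Membership in \<open>L_s\<close> is an equality at every
    \<open>\<omega>\<close>, also outside \<open>space M\<close> where entries need not be binary.
    So \<open>T\<close> repeats the sum on the word itself; the number of ones serves only to prove
    symmetry.\<close>
  define T where "T xs = (\<Sum>J | J \<subseteq> {1..n} \<and> card J = k. \<phi> (map (\<lambda>j. xs ! (j - 1)) (sorted_list_of_set J)))"
    for xs :: "nat list"
  have T_sum: "T xs = u_sum n k (\<lambda>i. \<phi> (binary_word k i)) (sum_list xs)" if xs: "xs \<in> binary_lists n" for xs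
  proof -
    have len: "length xs = n" and set: "set xs \<subseteq> {0, 1}" using xs by (auto simp: binary_lists_def)
    have "xs ! (j - 1) \<in> {0, 1}" if "j \<in> {1..n}" for j
      using that len by (intro subsetD[OF set] nth_mem) auto
    then have "T xs = u_sum n k (\<lambda>i. \<phi> (binary_word k i)) (\<Sum>j=1..n. xs ! (j - 1))"
      unfolding T_def by (rule subset_sum_eq_u_sum[OF _ sym])
    also have "(\<Sum>j=1..n. xs ! (j - 1)) = sum_list xs"
      unfolding sum_list_sum_nth len
      by (rule sum.reindex_bij_witness[of _ Suc "\<lambda>k. k - 1"]) auto
    finally show ?thesis .
  qed
  have "symmetric_kernel n T"
    unfolding symmetric_kernel_def
  proof (intro ballI impI)
    fix xs ys :: "nat list"
    assume "xs \<in> binary_lists n" "ys \<in> binary_lists n" "mset xs = mset ys"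
    moreover from this(3) have "sum_list xs = sum_list ys" by (metis sum_mset_sum_list)
    ultimately show "T xs = T ys" by (simp add: T_sum)
  qed
  moreover have "U_stat X n k \<phi> = (\<lambda>\<omega>. T (subvec X {1..n} \<omega>))"
  proof
    fix \<omega>
    have coords: "subvec X J \<omega> = map (\<lambda>j. subvec X {1..n} \<omega> ! (j - 1)) (sorted_list_of_set J)"
      if J: "J \<subseteq> {1..n}" for J
    proof -
      have fin: "finite J" using finite_subset[OF J] by simp
      have "X j \<omega> = subvec X {1..n} \<omega> ! (j - 1)" if "j \<in> J" for j
        using subsetD[OF J that] unfolding subvec_def sorted_list_of_set_Icc by (subst nth_map) (auto simp del: upt_Suc)
      then show ?thesis unfolding subvec_def[of X J] using fin by (intro map_cong refl) simp
    qed
    show "U_stat X n k \<phi> \<omega> = T (subvec X {1..n} \<omega>)"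
      unfolding U_stat_def T_def by (intro sum.cong refl arg_cong[where f = \<phi>] coords) auto
  qed
  ultimately show ?thesis unfolding L_s_def by (intro CollectI exI[of _ T] conjI)
qed

lemma expectation_U_stat:
  assumes "symmetric_kernel k \<phi>" and G: "\<And>\<omega>. \<omega> \<in> space M \<Longrightarrow> G \<omega> = g (sum_list (subvec X {1..n} \<omega>))"
  shows "(\<integral>\<omega>. U_stat X n k \<phi> \<omega> * G \<omega> \<partial>M) =
    (\<Sum>s\<le>n. real (n choose s) * moment s (n - s) * (u_sum n k (\<lambda>i. \<phi> (binary_word k i)) s * g s))"
proof -
  have "(\<integral>\<omega>. U_stat X n k \<phi> \<omega> * G \<omega> \<partial>M) =
    (\<integral>\<omega>. (\<lambda>s. u_sum n k (\<lambda>i. \<phi> (binary_word k i)) s * g s) (sum_list (subvec X {1..n} \<omega>)) \<partial>M)"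
    by (rule Bochner_Integration.integral_cong[OF refl]) (simp only: U_stat_eq_u_sum[OF assms(1)] G)
  then show ?thesis using expectation_sum[of "\<lambda>s. u_sum n k (\<lambda>i. \<phi> (binary_word k i)) s * g s" n] by simp
qed

lemma U_stat_in_SH_iff:
  assumes sym: "symmetric_kernel k \<phi>" and k: "1 \<le> k"
  shows "U_stat X n k \<phi> \<in> SH M X n k \<longleftrightarrow> orthogonal_kernel n k (\<lambda>i. \<phi> (binary_word k i))"
proof -
  let ?\<phi> = "\<lambda>i. \<phi> (binary_word k i)"
  have "SU X n k = {U_stat X n k \<phi> | \<phi>. symmetric_kernel k \<phi>}" using k by (simp add: SU_def)
  then have "U_stat X n k \<phi> \<in> SU X n k" using sym by blast
  then have "U_stat X n k \<phi> \<in> SH M X n k \<longleftrightarrow>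
      (\<forall>G\<in>SU X n (k - 1). (\<integral>\<omega>. U_stat X n k \<phi> \<omega> * G \<omega> \<partial>M) = 0)"
    using U_stat_in_L_s[OF sym] by (simp add: SH_def)
  also have "\<dots> \<longleftrightarrow> orthogonal_kernel n k ?\<phi>"
    unfolding orthogonal_kernel_def
  proof (intro iffI allI ballI)
    fix \<psi> assume *: "\<forall>G\<in>SU X n (k - 1). (\<integral>\<omega>. U_stat X n k \<phi> \<omega> * G \<omega> \<partial>M) = 0"
    show "(\<Sum>s\<le>n. real (n choose s) * moment s (n - s) * (u_sum n k ?\<phi> s * u_sum n (k - 1) \<psi> s)) = 0"
    \<comment> \<open>\<open>SU\<close> of order \<open>0\<close> is defined separately as the
      constants, which \<open>u_sum_0\<close> matches.\<close>
    proof (cases "k - 1 = 0")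
      case True
      have "(\<lambda>\<omega>. \<psi> 0) \<in> SU X n (k - 1)"
        unfolding SU_def if_P[OF True] by (intro CollectI exI[of _ "\<psi> 0"] conjI refl TrueI)
      from bspec[OF * this] show ?thesis
        unfolding expectation_U_stat[OF sym, of "\<lambda>\<omega>. \<psi> 0" "\<lambda>_. \<psi> 0" n, OF refl] True u_sum_0 .
    next
      case False
      have sym': "symmetric_kernel (k - 1) (\<lambda>xs. \<psi> (sum_list xs))" by (rule symmetric_kernel_sum_list)
      then have "U_stat X n (k - 1) (\<lambda>xs. \<psi> (sum_list xs)) \<in> SU X n (k - 1)"
        unfolding SU_def if_not_P[OF False]
        by (intro CollectI exI[of _ "\<lambda>xs. \<psi> (sum_list xs)"] conjI refl)
      then have "(\<integral>\<omega>. U_stat X n k \<phi> \<omega> * U_stat X n (k - 1) (\<lambda>xs. \<psi> (sum_list xs)) \<omega> \<partial>M) = 0" using * by blast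
      moreover have "(\<integral>\<omega>. U_stat X n k \<phi> \<omega> * U_stat X n (k - 1) (\<lambda>xs. \<psi> (sum_list xs)) \<omega> \<partial>M) =
        (\<Sum>s\<le>n. real (n choose s) * moment s (n - s) * (u_sum n k ?\<phi> s * u_sum n (k - 1) \<psi> s))"
        by (rule expectation_U_stat[OF sym]) (simp only: U_stat_eq_u_sum[OF sym'] sum_list_binary_word)
      ultimately show ?thesis by simp
    qed
  next
    fix G assume *: "\<forall>\<psi>. (\<Sum>s\<le>n. real (n choose s) * moment s (n - s) * (u_sum n k ?\<phi> s * u_sum n (k - 1) \<psi> s)) = 0"
      and G: "G \<in> SU X n (k - 1)"
    show "(\<integral>\<omega>. U_stat X n k \<phi> \<omega> * G \<omega> \<partial>M) = 0"
    proof (cases "k - 1 = 0")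
      case True
      then obtain c where "G = (\<lambda>\<omega>. c)" using G by (auto simp: SU_def)
      then show ?thesis
        using *[rule_format, of "\<lambda>_. c"] expectation_U_stat[OF sym, of G "\<lambda>_. c" n] True by simp
    next
      case False
      then obtain \<psi> where \<psi>: "G = U_stat X n (k - 1) \<psi>" "symmetric_kernel (k - 1) \<psi>"
        using G unfolding SU_def if_not_P[OF False] by blast
      have "(\<integral>\<omega>. U_stat X n k \<phi> \<omega> * G \<omega> \<partial>M) = (\<Sum>s\<le>n. real (n choose s) * moment s (n - s) *
          (u_sum n k ?\<phi> s * u_sum n (k - 1) (\<lambda>i. \<psi> (binary_word (k - 1) i)) s))"
        by (rule expectation_U_stat[OF sym]) (simp only: \<psi>(1) U_stat_eq_u_sum[OF \<psi>(2)])
      then show ?thesis using * by simp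
    qed
  qed
  finally show ?thesis .
qed

text \<open>Composition with \<open>sum_list\<close> turns a function of \<open>i\<close> into a
  symmetric kernel, and evaluation at \<open>binary_word\<close> goes back.\<close>

lemma hoeffding_decomposable_iff: "hoeffding_decomposable M X \<longleftrightarrow> decomposable"
proof
  assume H: "hoeffding_decomposable M X"
  show decomposable
    unfolding decomposable_def
  proof (intro allI impI ballI)
    fix n k :: nat and \<phi> :: "nat \<Rightarrow> real"
    assume nk: "2 \<le> n" "k \<in> {1..n}"
    have sym: "symmetric_kernel k (\<lambda>xs. \<phi> (sum_list xs))" by (rule symmetric_kernel_sum_list)
    have k: "1 \<le> k" using nk by simp
    have "U_stat X n k (\<lambda>xs. \<phi> (sum_list xs)) \<in> SH M X n k \<longleftrightarrow> (AE \<omega> in M.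
        real_cond_exp M (generated_by M X {2..k}) (\<lambda>\<omega>. \<phi> (sum_list (subvec X {1..k} \<omega>))) \<omega> = 0)"
      using H nk sym unfolding hoeffding_decomposable_def by blast
    then show "orthogonal_kernel n k \<phi> \<longleftrightarrow> degenerate_kernel k \<phi>"
      unfolding U_stat_in_SH_iff[OF sym k] degenerate_iff_cond_exp[OF k sym] by simp
  qed
next
  assume D: decomposable
  show "hoeffding_decomposable M X"
    unfolding hoeffding_decomposable_def
  proof (intro allI impI ballI)
    fix n k :: nat and \<phi> :: "nat list \<Rightarrow> real"
    assume nk: "2 \<le> n" "k \<in> {1..n}" and sym: "symmetric_kernel k \<phi>"
    have k: "1 \<le> k" using nk by simp
    show "U_stat X n k \<phi> \<in> SH M X n k \<longleftrightarrow> (AE \<omega> in M.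
        real_cond_exp M (generated_by M X {2..k}) (\<lambda>\<omega>. \<phi> (subvec X {1..k} \<omega>)) \<omega> = 0)"
      unfolding U_stat_in_SH_iff[OF sym k] degenerate_iff_cond_exp[OF k sym]
      using D nk by (simp only: decomposable_def)
  qed
qed

text \<open>All finite patterns have positive probability, so the almost sure identity amounts to an
  equation for every \<open>n\<close> and every number \<open>s\<close> of ones.\<close>

lemma urn_process_iff:
  "urn_process M X \<longleftrightarrow>
    (\<exists>f \<in> restrict_space borel {0..1::real} \<rightarrow>\<^sub>M restrict_space borel {0..1::real}.
      \<exists>r b :: nat. r > 0 \<and> b > 0 \<and>
        (\<forall>n\<ge>1. \<forall>s\<le>n. up s (n - s) = f (real (r + s) / real (r + b + n))))"
proof -
  have "(AE \<omega> in M. real_cond_exp M (generated_by M X {1..n}) (indicator {\<omega> \<in> space M. X (n + 1) \<omega> = 1}) \<omega> =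
        f (real (r + (\<Sum>i=1..n. X i \<omega>)) / real (r + b + n))) \<longleftrightarrow>
      (\<forall>s\<le>n. up s (n - s) = f (real (r + s) / real (r + b + n)))"
    if "n \<ge> 1" for n r b :: nat and f :: "real \<Rightarrow> real"
  proof -
    define g where "g ys = f (real (r + sum_list ys) / real (r + b + n))" for ys
    let ?S = "{\<omega> \<in> space M. X (n + 1) \<omega> = 1}"
    have Xn: "X (n + 1) -` {1} \<inter> space M \<in> sets M"
      by (rule measurable_sets[OF X_measurable_UNIV]) auto
    moreover have "?S = X (n + 1) -` {1} \<inter> space M" by auto
    ultimately have S: "?S \<in> sets M" by simp
    have int: "integrable M (indicator ?S :: 'a \<Rightarrow> real)"
      using S by (intro integrable_real_indicator) (auto simp: emeasure_eq_measure)
    have atom: "(\<integral>\<omega>. indicator {\<omega> \<in> space M. subvec X {1..n} \<omega> = ys} \<omega> * indicator ?S \<omega> \<partial>M) =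
        up (sum_list ys) (n - sum_list ys) * moment (sum_list ys) (n - sum_list ys)"
      if ys: "ys \<in> binary_lists n" for ys
    proof -
      have ys': "ys @ [1] \<in> binary_lists (Suc n)" using ys by (auto simp: binary_lists_def)
      have "(\<integral>\<omega>. indicator {\<omega> \<in> space M. subvec X {1..n} \<omega> = ys} \<omega> * indicator ?S \<omega> \<partial>M :: real) =
        (\<integral>\<omega>. indicator {\<omega> \<in> space M. subvec X {1..Suc n} \<omega> = ys @ [1]} \<omega> \<partial>M)"
        by (rule Bochner_Integration.integral_cong[OF refl])
          (simp add: subvec_Suc[unfolded One_nat_def] indicator_def)
      also have "\<dots> = prob {\<omega> \<in> space M. subvec X {1..Suc n} \<omega> = ys @ [1]}"
      proof -
        have "{\<omega> \<in> space M. subvec X {1..Suc n} \<omega> = ys @ [1]} \<in> sets M" by (rule event_sets) auto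
        then show ?thesis by simp
      qed
      also have "\<dots> = moment (Suc (sum_list ys)) (n - sum_list ys)"
        unfolding prob_pattern[OF ys'] by simp
      finally show ?thesis by (simp only: a_Suc_left)
    qed
    have "(AE \<omega> in M. real_cond_exp M (generated_by M X {1..n}) (indicator ?S) \<omega> =
        f (real (r + (\<Sum>i=1..n. X i \<omega>)) / real (r + b + n))) \<longleftrightarrow>
      (AE \<omega> in M. real_cond_exp M (generated_by M X {1..n}) (indicator ?S) \<omega> = g (subvec X {1..n} \<omega>))"
      unfolding g_def sum_list_subvec ..
    also have "\<dots> \<longleftrightarrow> (\<forall>ys\<in>binary_lists n. up (sum_list ys) (n - sum_list ys) * moment (sum_list ys) (n - sum_list ys) =
        g ys * moment (sum_list ys) (n - sum_list ys))"
    proof -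
      have "(AE \<omega> in M. real_cond_exp M (generated_by M X {1..n}) (indicator ?S) \<omega> = g (subvec X {1..n} \<omega>)) \<longleftrightarrow>
        (\<forall>ys\<in>binary_lists n. (\<integral>\<omega>. indicator {\<omega> \<in> space M. subvec X {1..n} \<omega> = ys} \<omega> * indicator ?S \<omega> \<partial>M) =
          g ys * prob {\<omega> \<in> space M. subvec X {1..n} \<omega> = ys})"
        using real_cond_exp_eq_iff[OF _ _ int, of "{1..n}" g] by simp
      also have "\<dots> \<longleftrightarrow> (\<forall>ys\<in>binary_lists n. up (sum_list ys) (n - sum_list ys) * moment (sum_list ys) (n - sum_list ys) =
          g ys * moment (sum_list ys) (n - sum_list ys))"
        by (intro ball_cong refl) (simp only: atom prob_pattern)
      finally show ?thesis .
    qed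
    also have "\<dots> \<longleftrightarrow> (\<forall>ys\<in>binary_lists n. up (sum_list ys) (n - sum_list ys) = f (real (r + sum_list ys) / real (r + b + n)))"
      using moment_pos by (intro ball_cong refl) (simp add: g_def less_imp_neq[symmetric])
    also have "\<dots> \<longleftrightarrow> (\<forall>s\<le>n. up s (n - s) = f (real (r + s) / real (r + b + n)))"
    proof (intro iffI allI impI ballI)
      fix s assume *: "\<forall>ys\<in>binary_lists n. up (sum_list ys) (n - sum_list ys) = f (real (r + sum_list ys) / real (r + b + n))"
        and "s \<le> n"
      from *[rule_format, OF binary_word_in[OF this(2)]] show "up s (n - s) = f (real (r + s) / real (r + b + n))" by simp
    next
      fix ys assume *: "\<forall>s\<le>n. up s (n - s) = f (real (r + s) / real (r + b + n))" and "ys \<in> binary_lists n"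
      from *[rule_format, OF sum_list_binary_le[OF this(2)]]
      show "up (sum_list ys) (n - sum_list ys) = f (real (r + sum_list ys) / real (r + b + n))" .
    qed
    finally show ?thesis .
  qed
  then show ?thesis unfolding urn_process_def by (intro bex_cong refl arg_cong[where f = Ex] ext conj_cong) auto
qed

end

section \<open>Polya sequences and urn processes identified by their predictive rule\<close>

context mixed_binary_process begin

lemma polya_sequence_iff:
  assumes "\<alpha> > 0" "\<beta> > 0"
  shows "polya_sequence M X \<alpha> \<beta> \<longleftrightarrow> polya \<alpha> \<beta>"
proof
  assume "polya_sequence M X \<alpha> \<beta>"
  then have df: "is_de_finetti_measure M X (beta_measure \<alpha> \<beta>)" by (simp add: polya_sequence_def)
  \<comment> \<open>A second interpretation of the same process with the Beta measure: both measures
    give the same pattern probabilities, hence equal moments.\<close>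
  interpret beta: binary_process M X "beta_measure \<alpha> \<beta>"
    by unfold_locales (use X_measurable df in auto)
  have eq: "moment i j = pochhammer \<alpha> i * pochhammer \<beta> j / pochhammer (\<alpha> + \<beta>) (i + j)" for i j
  proof -
    have word: "binary_word (i + j) i \<in> binary_lists (i + j)" by simp
    have "moment i j = beta.moment i j"
      using prob_pattern[OF word] beta.prob_pattern[OF word] by simp
    also have "\<dots> = Beta (\<alpha> + i) (\<beta> + j) / Beta \<alpha> \<beta>"
      unfolding beta.moment_def by (rule integral_beta_measure[OF assms])
    finally show ?thesis by (simp only: Beta_pochhammer[OF assms])
  qed
  show "polya \<alpha> \<beta>"
    unfolding polya_def
  proof (intro allI)
    fix i j
    have nz: "pochhammer \<alpha> i \<noteq> 0" "pochhammer \<beta> j \<noteq> 0" "pochhammer (\<alpha> + \<beta>) (i + j) \<noteq> 0"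
      using assms by (metis pochhammer_pos add_pos_pos less_irrefl)+
    have "\<alpha> + \<beta> + i + j \<noteq> 0" using assms by (simp add: add_pos_nonneg less_imp_neq[symmetric])
    then show "up i j * (\<alpha> + \<beta> + i + j) = \<alpha> + i"
      using nz by (simp add: up_def eq pochhammer_Suc add.assoc)
  qed
next
  assume polya: "polya \<alpha> \<beta>"
  have moment: "(\<integral>\<theta>. \<theta> ^ i * (1 - \<theta>) ^ j \<partial>beta_measure \<alpha> \<beta>) = (\<integral>\<theta>. \<theta> ^ i * (1 - \<theta>) ^ j \<partial>\<gamma>)" for i j
    using polya_pochhammer[OF polya assms, of i j] unfolding integral_beta_measure[OF assms] Beta_pochhammer[OF assms]
    by (simp only: moment_def)
  have "is_de_finetti_measure M X (beta_measure \<alpha> \<beta>)"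
    using de_finetti prob_space_beta_measure[OF assms] sets_beta_measure
    unfolding is_de_finetti_measure_def moment by simp
  then show "polya_sequence M X \<alpha> \<beta>" using assms by (simp add: polya_sequence_def)
qed

lemma polya_imp_urn_process:
  assumes polya: "polya (real r) (real b)" and rb: "r > 0" "b > 0"
  shows "urn_process M X"
  unfolding urn_process_iff
proof (intro bexI exI conjI allI impI)
  fix n s :: nat assume "s \<le> n"
  then have "real r + real b + real s + real (n - s) = real (r + b + n)" by simp
  moreover have "up s (n - s) * (real r + real b + real s + real (n - s)) = real r + real s"
    using polya by (simp add: polya_def)
  \<comment> \<open>The urn function is the identity, with \<open>r\<close> and \<open>b\<close> as
    initial composition.\<close>
  ultimately show "up s (n - s) = (\<lambda>x. x) (real (r + s) / real (r + b + n))"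
    using rb by (simp add: eq_divide_eq add.assoc)
qed (use rb in auto)

lemma urn_process_imp_polya:
  assumes urn: "urn_process M X" and c1: "moment 1 0 = c1" and c2: "moment 2 0 = c2" and c: "c1\<^sup>2 < c2"
  obtains r b :: nat where "r > 0" "b > 0" "polya (real r) (real b)"
proof -
  obtain f and r b :: nat where rb: "r > 0" "b > 0" and
    f: "\<And>n s. n \<ge> 1 \<Longrightarrow> s \<le> n \<Longrightarrow> up s (n - s) = f (real (r + s) / real (r + b + n))"
    using urn unfolding urn_process_iff by blast
  \<comment> \<open>Large enough that \<open>x - r\<close> and \<open>y - b\<close> are genuine
    differences and at least one draw has been made, as the urn equation requires.\<close>
  define K where "K = Suc (r + b)"
  have up_f: "up i j = f (ratio (r + i) (b + j))" if "i + j \<ge> 1" for i j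
    using f[OF that, of i] by (simp add: ratio_def add_ac)
  have f_up: "f (ratio x y) = up (x - r) (y - b)" if "x \<ge> r" "y \<ge> b" "x + y > r + b" for x y
    using up_f[of "x - r" "y - b"] that by simp
  interpret homogeneous_urn f K
  proof
    show "0 < K" by (simp add: K_def)
  next
    fix x y assume xy: "x \<ge> K" "y \<ge> K"
    then have eqs: "f (ratio x y) = up (x - r) (y - b)" "f (ratio (Suc x) y) = up (Suc (x - r)) (y - b)"
        "f (ratio x (Suc y)) = up (x - r) (Suc (y - b))"
      by (auto simp: f_up K_def Suc_diff_le)
    show "0 < f (ratio x y)" "f (ratio x y) < 1" "f (ratio x y) \<le> f (ratio (Suc x) y)"
      unfolding eqs by (rule up_pos up_less_1 up_mono)+
    show "f (ratio x y) = f (ratio x y) * f (ratio (Suc x) y) + (1 - f (ratio x y)) * f (ratio x (Suc y))"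
      unfolding eqs by (rule up_harmonic)
  qed
  have a01: "moment 0 1 = 1 - c1" using a_merge[of 0 0] unfolding One_nat_def[symmetric] a_00 c1 by simp
  have a11: "moment 1 1 = c1 - c2" using a_merge[of 1 0] unfolding Suc_1 One_nat_def[symmetric] c1 c2 by simp
  have up1: "c2 = up 1 0 * c1" "c1 - c2 = up 0 1 * (1 - c1)"
    using a_Suc_left[of 1 0] a_Suc_left[of 0 1] unfolding Suc_1 One_nat_def[symmetric] c1 c2 a01 a11 by auto
  have Q: "ratio (r + i) (b + j) \<in> Q01" for i j using rb by (intro ratio_in_Rats_01) auto
  from identity_or_constant show ?thesis
  proof
    assume "\<exists>c. \<forall>z\<in>Q01. f z = c"
    then obtain c where const: "\<And>z. z \<in> Q01 \<Longrightarrow> f z = c" by blast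
    \<comment> \<open>If the first draw does not influence the second, then
      \<open>c2 = c1\<^sup>2\<close>, contrary to the strict inequality.\<close>
    have "up 1 0 = c" "up 0 1 = c" using const[OF Q[of 1 0]] const[OF Q[of 0 1]] up_f[of 1 0] up_f[of 0 1] by auto
    with up1 have "c = c1" "c2 = c * c1" by (auto simp: algebra_simps)
    then show ?thesis using c by (simp add: power2_eq_square)
  next
    assume id: "\<forall>z\<in>Q01. f z = z"
    have up_eq: "up i j * (real r + real b + i + j) = real r + i" if "i + j \<ge> 1" for i j
    proof -
      have "up i j = ratio (r + i) (b + j)" using up_f[OF that] id Q[of i j] by simp
      then show ?thesis using rb by (simp add: ratio_def add_ac)
    qed
    \<comment> \<open>The urn equation starts at \<open>n = 1\<close>, so the rule at
      \<open>(0, 0)\<close> is recovered by averaging the two values after one draw.\<close>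
    define T where "T = real r + real b + 1"
    have T: "up 1 0 * T = real r + 1" "up 0 1 * T = real r"
      using up_eq[of 1 0] up_eq[of 0 1] by (auto simp: T_def)
    have "c2 * T = c1 * (up 1 0 * T)" "(c1 - c2) * T = (1 - c1) * (up 0 1 * T)"
      unfolding up1(2) by (simp_all add: up1(1))
    then have "c1 * (real r + real b) = real r"
      unfolding T by (simp add: T_def algebra_simps)
    moreover have "up 0 0 = c1" using a_00 c1 by (simp add: up_def)
    ultimately have "up i j * (real r + real b + i + j) = real r + i" for i j
      using up_eq[of i j] by (cases "i = 0 \<and> j = 0") (auto simp: Suc_le_eq)
    then have "polya (real r) (real b)" by (simp add: polya_def)
    then show ?thesis using that rb by blast
  qed
qed

end

text \<open>With \<open>S = \<alpha> + \<beta>\<close> both \<open>c1 - c2\<close> and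
  \<open>c2 - c1\<^sup>2\<close> are explicit multiples of \<open>c1 * (1 - c1) / (S + 1)\<close>,
  and their quotient is \<open>S\<close>.\<close>

lemma beta_parameters:
  fixes \<alpha> \<beta> c1 c2 :: real
  assumes "\<alpha> > 0" "\<beta> > 0" "\<alpha> / (\<alpha> + \<beta>) = c1"
    and "\<alpha> * (\<alpha> + 1) / ((\<alpha> + \<beta>) * (\<alpha> + \<beta> + 1)) = c2"
  shows "c1 * (c1 - c2) / (c2 - c1\<^sup>2) = \<alpha>" "(1 - c1) * (c1 - c2) / (c2 - c1\<^sup>2) = \<beta>"
proof -
  define S where "S = \<alpha> + \<beta>"
  have S: "S > 0" using assms by (simp add: S_def)
  have \<alpha>: "\<alpha> = c1 * S" and \<beta>: "\<beta> = (1 - c1) * S"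
    using assms(3) S by (auto simp: S_def field_simps)
  have c1: "c1 > 0" "c1 < 1" using assms(1,2) S \<alpha> \<beta> by (auto simp: zero_less_mult_iff)
  have c2: "c2 = c1 * (c1 * S + 1) / (S + 1)"
  proof -
    have "c2 = c1 * S * (c1 * S + 1) / (S * (S + 1))"
      using assms(4) unfolding S_def[symmetric] unfolding \<alpha> by simp
    also have "\<dots> = c1 * (c1 * S + 1) / (S + 1)" using S by (simp add: divide_simps)
    finally show ?thesis .
  qed
  have d1: "c1 - c2 = c1 * (1 - c1) * S / (S + 1)" using S unfolding c2 by (simp add: field_simps)
  have d2: "c2 - c1\<^sup>2 = c1 * (1 - c1) / (S + 1)" using S unfolding c2 by (simp add: field_simps power2_eq_square)
  have "(c1 - c2) / (c2 - c1\<^sup>2) = S" unfolding d1 d2 using S c1 by simp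
  then show "c1 * (c1 - c2) / (c2 - c1\<^sup>2) = \<alpha>" "(1 - c1) * (c1 - c2) / (c2 - c1\<^sup>2) = \<beta>"
    unfolding times_divide_eq_right[symmetric] by (simp_all only: \<alpha>[symmetric] \<beta>[symmetric])
qed

theorem corollary5:
  fixes M :: "'a measure" and X :: "nat \<Rightarrow> 'a \<Rightarrow> nat" and c1 c2 :: real
  assumes "prob_space M"
    and "\<forall>n\<ge>1. X n \<in> M \<rightarrow>\<^sub>M count_space {0, 1}"
    and "sets M = sets (generated_by M X {1..})"
    and "exchangeable M X"
    and "nondeterministic M X"
    and "\<P>(\<omega> in M. X 1 \<omega> = 1) = c1"
    and "\<P>(\<omega> in M. X 1 \<omega> = 1 \<and> X 2 \<omega> = 1) = c2"
    and "0 < c1\<^sup>2" and "c1\<^sup>2 < c2" and "c2 < c1" and "c1 < 1"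
  shows "((\<exists>\<alpha> \<beta> :: real. \<alpha> \<in> \<int> \<and> \<beta> \<in> \<int> \<and> \<alpha> > 0 \<and> \<beta> > 0 \<and>
             \<alpha> / (\<alpha> + \<beta>) = c1 \<and>
             \<alpha> * (\<alpha> + 1) / ((\<alpha> + \<beta>) * (\<alpha> + \<beta> + 1)) = c2) \<longrightarrow>
          (hoeffding_decomposable M X \<longleftrightarrow> urn_process M X)) \<and>
         (hoeffding_decomposable M X \<longleftrightarrow>
            polya_sequence M X (c1 * (c1 - c2) / (c2 - c1\<^sup>2))
                               ((1 - c1) * (c1 - c2) / (c2 - c1\<^sup>2)))"
proof -
  let ?\<alpha> = "c1 * (c1 - c2) / (c2 - c1\<^sup>2)" and ?\<beta> = "(1 - c1) * (c1 - c2) / (c2 - c1\<^sup>2)"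
  obtain \<gamma> where \<gamma>: "is_de_finetti_measure M X \<gamma>" using assms(5) unfolding nondeterministic_def by blast
  interpret prob_space M by (rule assms(1))
  interpret process: binary_process M X \<gamma>
    by unfold_locales (use assms(2) \<gamma> in auto)
  have m: "process.moment 1 0 = c1" "process.moment 2 0 = c2"
    using assms(6,7) process.prob_first process.prob_first_two by auto
  \<comment> \<open>Positivity of this moment, from \<open>c2 < c1\<close>, is what the next locale
    requires.\<close>
  have "process.moment 1 1 = c1 - c2"
    using process.moment_merge[of 1 0] unfolding Suc_1 One_nat_def[symmetric] m by simp
  then interpret mixed_binary_process M X \<gamma>
    by unfold_locales (use assms(10) in simp)
  have c1: "0 < c1" using assms(9-10) zero_le_power2[of c1] by linarith
  have pos: "?\<alpha> > 0" "?\<beta> > 0" using c1 assms(9-11) by auto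
  have b: "hoeffding_decomposable M X \<longleftrightarrow> polya ?\<alpha> ?\<beta>"
    unfolding hoeffding_decomposable_iff
    using decomposable_imp_polya[OF _ m c1 assms(9-11)] polya_imp_decomposable[OF _ pos] by blast
  have a: "hoeffding_decomposable M X \<longleftrightarrow> urn_process M X"
    if params: "\<alpha> \<in> \<int>" "\<beta> \<in> \<int>" "\<alpha> > 0" "\<beta> > 0" "\<alpha> / (\<alpha> + \<beta>) = c1"
      "\<alpha> * (\<alpha> + 1) / ((\<alpha> + \<beta>) * (\<alpha> + \<beta> + 1)) = c2" for \<alpha> \<beta> :: real
  proof
    assume "hoeffding_decomposable M X"
    then have "polya \<alpha> \<beta>" using b beta_parameters[OF params(3-6)] by simp
    \<comment> \<open>Positive integer parameters are numbers of balls, so they can serve as the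
      initial urn.\<close>
    moreover have "\<alpha> = real (nat \<lfloor>\<alpha>\<rfloor>)" "\<beta> = real (nat \<lfloor>\<beta>\<rfloor>)"
      using params(1-4) by (auto elim!: Ints_cases)
    then obtain r b :: nat where "\<alpha> = real r" "\<beta> = real b" by blast
    ultimately show "urn_process M X"
      using polya_imp_urn_process[of r b] params(3,4) by simp
  next
    assume "urn_process M X"
    from urn_process_imp_polya[OF this m assms(9)] obtain r b :: nat
      where rb: "r > 0" "b > 0" "polya (real r) (real b)" .
    \<comment> \<open>The predictive rule at \<open>(0, 0)\<close> and \<open>(1, 0)\<close> shows
      that \<open>(r, b)\<close> solves the system in \<open>c1\<close> and \<open>c2\<close>, so
      \<open>beta_parameters\<close> identifies it with
      \<open>(?\<alpha>, ?\<beta>)\<close>.\<close>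
    have up: "up 0 0 = c1" "up 1 0 * c1 = c2"
      using m a_00 a_Suc_left[of 1 0] by (auto simp: up_def numeral_2_eq_2)
    have p: "c1 * (real r + real b) = real r" "up 1 0 * (real r + real b + 1) = real r + 1"
      using rb(3)[unfolded polya_def, rule_format, of 0 0] rb(3)[unfolded polya_def, rule_format, of 1 0] up by auto
    have e1: "real r / (real r + real b) = c1" using p(1) rb(1) by (simp add: divide_eq_eq)
    have "c2 * ((real r + real b) * (real r + real b + 1)) =
      (c1 * (real r + real b)) * (up 1 0 * (real r + real b + 1))"
      by (simp only: up(2)[symmetric] mult_ac)
    then have "real r * (real r + 1) = c2 * ((real r + real b) * (real r + real b + 1))"
      by (simp only: p)
    then have "real r * (real r + 1) / ((real r + real b) * (real r + real b + 1)) = c2"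
      using rb(1) by (simp add: divide_eq_eq)
    from beta_parameters[OF _ _ e1 this] rb show "hoeffding_decomposable M X" unfolding b by simp
  qed
  show ?thesis
    using a b polya_sequence_iff[OF pos] by blast
qed

end
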